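(* Let $\Delta$ be a $(d-1)$-dimensional simplicial complex on $n$ vertices and let $\mathbf k$ be a field of positive prime characteristic $p$. Let $R=\mathbf k[\Delta]$ be the Stanley-Reisner ring of $\Delta$, let $\mathfrak m$ be its unique maximal homogeneous ideal, and let $I_1,\dots,I_g$ be ideals of $R$, each generated by a linear system of parameters of $R$. Then: (1) $I_i^*=\mathfrak m$ for all $i=1,\dots,g$. (2) For all $s_1,\dots,s_g\in\mathbb N$, $(I_1^{s_1}I_2^{s_2}\cdots I_g^{s_g})^*=\mathfrak m^{s_1+s_2+\cdots+s_g}$.
   Context: $\mathbf k[\Delta]=\mathbf k[X_1,\dots,X_n]/I_\Delta$ with $I_\Delta$ the Stanley-Reisner ideal; it has dimension $d$. A linear system of parameters is a (homogeneous) system of parameters of $\mathbf k[\Delta]$ consisting of linear forms. $J^*$ denotes the tight closure of an ideal $J$: $x\in J^*$ iff there is $c\in R$, not in any minimal prime of $R$, with $cx^q\in J^{[q]}$ for all sufficiently large $q=p^e$, where $J^{[q]}$ is generated by the $q$-th powers of elements of $J$. *)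

theory Defs
  imports "HOL-Algebra.Algebra" "HOL-Library.Poly_Mapping" "HOL-Computational_Algebra.Primes"
begin

text \<open>
  The empty face is always present and every element of \<open>{1..n}\<close> is a vertex, so the complex has
  exactly \<open>n\<close> vertices; \<open>n = 0\<close> gives the complex whose only face is the empty one.
\<close>

definition simplicial_complex :: "nat \<Rightarrow> nat set set \<Rightarrow> bool" where
  "simplicial_complex n \<Delta> \<longleftrightarrow>
     (\<forall>F\<in>\<Delta>. F \<subseteq> {1..n}) \<and> (\<forall>F\<in>\<Delta>. \<forall>G. G \<subseteq> F \<longrightarrow> G \<in> \<Delta>) \<and> {} \<in> \<Delta> \<and> (\<forall>i\<in>{1..n}. {i} \<in> \<Delta>)"

definition complex_dim :: "nat set set \<Rightarrow> int" where
  "complex_dim \<Delta> = int (Max (card ` \<Delta>)) - 1"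

text \<open>
  Polynomials in variables indexed by the naturals: a polynomial maps exponent vectors to
  coefficients, both finitely supported.
\<close>

type_synonym 'k mpoly = "(nat \<Rightarrow>\<^sub>0 nat) \<Rightarrow>\<^sub>0 'k"

definition mono_deg :: "(nat \<Rightarrow>\<^sub>0 nat) \<Rightarrow> nat" where
  "mono_deg m = (\<Sum>i\<in>Poly_Mapping.keys m. Poly_Mapping.lookup m i)"

definition homogeneous_poly :: "nat \<Rightarrow> ('k::zero) mpoly \<Rightarrow> bool" where
  "homogeneous_poly k f \<longleftrightarrow> (\<forall>m\<in>Poly_Mapping.keys f. mono_deg m = k)"

definition poly_var :: "nat \<Rightarrow> ('k::field) mpoly" where
  "poly_var i = Poly_Mapping.single (Poly_Mapping.single i 1) 1"

definition poly_ring :: "nat \<Rightarrow> (('k::field) mpoly) ring" where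
  "poly_ring n = \<lparr> carrier = {f. \<forall>m\<in>Poly_Mapping.keys f. Poly_Mapping.keys m \<subseteq> {1..n}},
                   monoid.mult = (*), one = 1, ring.zero = 0, add = (+) \<rparr>"

definition sr_ideal :: "nat \<Rightarrow> nat set set \<Rightarrow> ('k::field) mpoly set" where
  "sr_ideal n \<Delta> = Idl\<^bsub>poly_ring n\<^esub> {\<Prod>i\<in>F. poly_var i | F. F \<subseteq> {1..n} \<and> F \<notin> \<Delta>}"

definition sr_ring :: "nat \<Rightarrow> nat set set \<Rightarrow> (('k::field) mpoly set) ring" where
  "sr_ring n \<Delta> = poly_ring n Quot sr_ideal n \<Delta>"

definition sr_component :: "nat \<Rightarrow> nat set set \<Rightarrow> nat \<Rightarrow> ('k::field) mpoly set set" where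
  "sr_component n \<Delta> k =
     {sr_ideal n \<Delta> +>\<^bsub>poly_ring n\<^esub> f | f. f \<in> carrier (poly_ring n) \<and> homogeneous_poly k f}"

definition homogeneous_ideal :: "nat \<Rightarrow> nat set set \<Rightarrow> ('k::field) mpoly set set \<Rightarrow> bool" where
  "homogeneous_ideal n \<Delta> J \<longleftrightarrow> (\<exists>S \<subseteq> (\<Union>k. sr_component n \<Delta> k). J = Idl\<^bsub>sr_ring n \<Delta>\<^esub> S)"

text \<open>Maximality is meant among the proper homogeneous ideals.\<close>

definition maximal_homogeneous_ideal ::
    "nat \<Rightarrow> nat set set \<Rightarrow> ('k::field) mpoly set set \<Rightarrow> bool" where
  "maximal_homogeneous_ideal n \<Delta> M \<longleftrightarrow>
     homogeneous_ideal n \<Delta> M \<and> M \<noteq> carrier (sr_ring n \<Delta>) \<and>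
     (\<forall>J. homogeneous_ideal n \<Delta> J \<and> J \<noteq> carrier (sr_ring n \<Delta>) \<and> M \<subseteq> J \<longrightarrow> J = M)"

definition the_maximal_homogeneous_ideal ::
    "nat \<Rightarrow> nat set set \<Rightarrow> ('k::field) mpoly set set" where
  "the_maximal_homogeneous_ideal n \<Delta> = (THE M. maximal_homogeneous_ideal n \<Delta> M)"

definition prime_chain :: "('a, 'b) ring_scheme \<Rightarrow> nat \<Rightarrow> bool" where
  "prime_chain R r \<longleftrightarrow>
     (\<exists>Q :: nat \<Rightarrow> 'a set. (\<forall>i\<le>r. primeideal (Q i) R) \<and> (\<forall>i<r. Q i \<subset> Q (Suc i)))"

text \<open>
  Krull dimension as a relation: the zero ring and rings of infinite dimension satisfy it for no
  natural number.
\<close>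

definition has_krull_dim :: "('a, 'b) ring_scheme \<Rightarrow> nat \<Rightarrow> bool" where
  "has_krull_dim R d \<longleftrightarrow> prime_chain R d \<and> (\<forall>r. prime_chain R r \<longrightarrow> r \<le> d)"

definition homogeneous_sop ::
    "nat \<Rightarrow> nat set set \<Rightarrow> ('k::field) mpoly set list \<Rightarrow> bool" where
  "homogeneous_sop n \<Delta> \<theta> \<longleftrightarrow>
     (\<forall>t\<in>set \<theta>. \<exists>k\<ge>1. t \<in> sr_component n \<Delta> k) \<and>
     has_krull_dim (sr_ring n \<Delta> :: ('k mpoly set) ring) (length \<theta>) \<and>
     has_krull_dim (sr_ring n \<Delta> Quot (Idl\<^bsub>sr_ring n \<Delta>\<^esub> (set \<theta>))) 0"

definition linear_sop ::
    "nat \<Rightarrow> nat set set \<Rightarrow> ('k::field) mpoly set list \<Rightarrow> bool" where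
  "linear_sop n \<Delta> \<theta> \<longleftrightarrow> homogeneous_sop n \<Delta> \<theta> \<and> set \<theta> \<subseteq> sr_component n \<Delta> 1"

definition minimal_prime :: "('a, 'b) ring_scheme \<Rightarrow> 'a set \<Rightarrow> bool" where
  "minimal_prime R Q \<longleftrightarrow>
     primeideal Q R \<and> (\<forall>Q'. primeideal Q' R \<and> Q' \<subseteq> Q \<longrightarrow> Q' = Q)"

definition frobenius_power :: "('a, 'b) ring_scheme \<Rightarrow> 'a set \<Rightarrow> nat \<Rightarrow> 'a set" where
  "frobenius_power R J q = Idl\<^bsub>R\<^esub> {x [^]\<^bsub>R\<^esub> q | x. x \<in> J}"

definition tight_closure :: "nat \<Rightarrow> ('a, 'b) ring_scheme \<Rightarrow> 'a set \<Rightarrow> 'a set" where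
  "tight_closure p R J =
     {x \<in> carrier R. \<exists>c\<in>carrier R. (\<forall>Q. minimal_prime R Q \<longrightarrow> c \<notin> Q) \<and>
        (\<exists>e0. \<forall>e\<ge>e0. c \<otimes>\<^bsub>R\<^esub> (x [^]\<^bsub>R\<^esub> (p ^ e)) \<in> frobenius_power R J (p ^ e))}"

end

(*
  A linear system of parameters restricts, on every face F, to a spanning set of the linear forms in
  the variables of F: otherwise its members vanish on a line in the coordinate subspace of F, and
  R/I has positive dimension. Hence the s-fold products J of such ideals and the power m^s, which
  contains J, have the same image modulo every minimal prime, that is, in every k[F] for a facet F.

  The product x_F of the variables of a facet F is annihilated by the minimal prime of F. So for x in
  m^s and l in J agreeing with x modulo that prime, x_F * x^q = x_F * l^q lies in J^[q], and the sum
  of all x_F, which avoids all minimal primes, multiplies x^q into J^[q] for every q. Conversely, if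
  c * x^q lies in J^[q], hence in m^(s q), for large q, comparing orders of vanishing in the domains
  k[F] shows that x lies in m^s.
*)

theory Submission
  imports Defs
begin

text \<open>The element \<open>l\<close> agreeing with \<open>x\<close> modulo the minimal prime of
  F depends on F: since R is reduced, an element serving all facets would be \<open>x\<close>
  itself. This is why the multiplier is a sum: each x_F sees only its own facet, and the ideal J^[q]
  collects the contributions. Restriction to F is a ring homomorphism, so agreement of
  \<open>x\<close> and \<open>l\<close> persists for q-th powers, and one multiplier serves all q.

  Both claims are the same statement about a pair (J, s), recorded as
  \<open>facetwise_reduction\<close>; such pairs multiply, so ideals generated by parameters have to
  be studied for s = 1 only. Dimension is defined through chains of primes, so positive dimension of
  R/I means exhibiting two nested primes above I: the kernel of evaluation along the line, and m
  itself. Most computations rest on the Stanley-Reisner ideal being spanned by monomials: membership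
  in it, in a minimal prime and in m^s is decided by exponents.\<close>

abbreviation lookup :: "('a \<Rightarrow>\<^sub>0 'b::zero) \<Rightarrow> 'a \<Rightarrow> 'b" where "lookup \<equiv> Poly_Mapping.lookup"
abbreviation keys :: "('a \<Rightarrow>\<^sub>0 'b::zero) \<Rightarrow> 'a set" where "keys \<equiv> Poly_Mapping.keys"
abbreviation single :: "'a \<Rightarrow> 'b \<Rightarrow> 'a \<Rightarrow>\<^sub>0 'b::zero" where "single \<equiv> Poly_Mapping.single"

section \<open>Polynomials\<close>

lemma sum_single_lookup:
  fixes f :: "'a \<Rightarrow>\<^sub>0 'b::comm_monoid_add"
  shows "(\<Sum>m\<in>keys f. single m (lookup f m)) = f"
proof (rule poly_mapping_eqI)
  fix k
  show "lookup (\<Sum>m\<in>keys f. single m (lookup f m)) k = lookup f k"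
    by (cases "k \<in> keys f") (auto simp: lookup_sum lookup_single when_def in_keys_iff)
qed

lemma keys_add_nat: "keys (m + m') = keys m \<union> keys (m' :: nat \<Rightarrow>\<^sub>0 nat)"
  by (auto simp: in_keys_iff lookup_add)

lemma mono_deg_superset:
  assumes "finite S" "keys m \<subseteq> S"
  shows "mono_deg m = (\<Sum>i\<in>S. lookup m i)"
  unfolding mono_deg_def using assms by (intro sum.mono_neutral_left) (auto simp: in_keys_iff)

lemma mono_deg_add: "mono_deg (m + m') = mono_deg m + mono_deg m'"
  by (simp add: mono_deg_superset[of "keys m \<union> keys m'"] keys_add_nat lookup_add sum.distrib)

lemma mono_deg_single: "mono_deg (single i k) = k"
  by (simp add: mono_deg_def)

lemma mono_deg_eq_0: "mono_deg m = 0 \<longleftrightarrow> m = 0"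
  by (auto simp: mono_deg_def in_keys_iff simp flip: keys_eq_empty)

lemma mono_deg_1: "mono_deg m = 1 \<longleftrightarrow> (\<exists>i. m = single i 1)"
proof
  assume m: "mono_deg m = 1"
  then obtain i where i: "i \<in> keys m"
    by (metis ex_in_conv keys_eq_empty mono_deg_eq_0 zero_neq_one)
  have "m = single i 1 + (m - single i 1)"
    using i by (intro poly_mapping_eqI) (auto simp: lookup_add lookup_minus lookup_single when_def in_keys_iff)
  with m have "mono_deg (m - single i 1) = 0"
    by (metis Nat.add_0_right add_left_cancel mono_deg_add mono_deg_single)
  then show "\<exists>i. m = single i 1"
    by (metis \<open>m = single i 1 + (m - single i 1)\<close> add.right_neutral mono_deg_eq_0)
qed (auto simp: mono_deg_single)

text \<open>Covers two maps at once: truncation to a set of exponents (\<open>g\<close> the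
  identity, \<open>w\<close> an indicator) and pullback along a line (\<open>g\<close> the degree,
  \<open>w\<close> the value of the monomial at a point). Multiplicativity is then proved once, for
  additive \<open>g\<close> and multiplicative \<open>w\<close>.\<close>

definition monomial_hom ::
    "('m \<Rightarrow> 'n) \<Rightarrow> ('m \<Rightarrow> 'a) \<Rightarrow> ('m \<Rightarrow>\<^sub>0 'a) \<Rightarrow> ('n \<Rightarrow>\<^sub>0 'a::comm_semiring_1)" where
  "monomial_hom g w f = (\<Sum>m\<in>keys f. single (g m) (lookup f m * w m))"

lemma monomial_hom_superset:
  assumes "finite S" "keys f \<subseteq> S"
  shows "monomial_hom g w f = (\<Sum>m\<in>S. single (g m) (lookup f m * w m))"
  unfolding monomial_hom_def using assms by (intro sum.mono_neutral_left) (auto simp: in_keys_iff)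

lemma monomial_hom_single: "monomial_hom g w (single m c) = single (g m) (c * w m)"
  by (simp add: monomial_hom_def)

lemma monomial_hom_0 [simp]: "monomial_hom g w 0 = 0"
  by (simp add: monomial_hom_def)

lemma monomial_hom_add: "monomial_hom g w (f + f') = monomial_hom g w f + monomial_hom g w f'"
proof -
  have "keys (f + f') \<subseteq> keys f \<union> keys f'" by (rule keys_add)
  then show ?thesis
    by (simp add: monomial_hom_superset[of "keys f \<union> keys f'"] lookup_add algebra_simps
        single_add sum.distrib)
qed

lemma monomial_hom_sum: "monomial_hom g w (sum f S) = (\<Sum>x\<in>S. monomial_hom g w (f x))"
  by (induction S rule: infinite_finite_induct) (auto simp: monomial_hom_add)

lemma monomial_hom_1:
  assumes "g 0 = 0" "w 0 = 1"
  shows "monomial_hom g w 1 = 1"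
  using assms by (metis monomial_hom_single mult_1 single_one)

lemma monomial_hom_mult:
  fixes g :: "'m::comm_monoid_add \<Rightarrow> 'n::comm_monoid_add"
  assumes g: "\<And>m m'. g (m + m') = g m + g m'" and w: "\<And>m m'. w (m + m') = w m * w m'"
  shows "monomial_hom g w (f * f') = monomial_hom g w f * monomial_hom g w f'"
proof -
  have "monomial_hom g w (f * f') = monomial_hom g w
      ((\<Sum>m\<in>keys f. single m (lookup f m)) * (\<Sum>m\<in>keys f'. single m (lookup f' m)))"
    by (simp only: sum_single_lookup)
  also have "\<dots> = monomial_hom g w f * monomial_hom g w f'"
    by (simp add: sum_product monomial_hom_sum mult_single monomial_hom_single)
      (simp add: monomial_hom_def sum_product mult_single g w algebra_simps)
  finally show ?thesis .
qed

definition part :: "('m \<Rightarrow> bool) \<Rightarrow> ('m \<Rightarrow>\<^sub>0 'a) \<Rightarrow> ('m \<Rightarrow>\<^sub>0 'a::comm_semiring_1)" where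
  "part P = monomial_hom (\<lambda>m. m) (\<lambda>m. of_bool (P m))"

lemma lookup_part: "lookup (part P f) m = (if P m then lookup f m else 0)"
  by (auto simp: part_def monomial_hom_def lookup_sum lookup_single when_def in_keys_iff)

lemma keys_part: "keys (part P f) = {m \<in> keys f. P m}"
  by (auto simp: in_keys_iff lookup_part split: if_splits)

lemma part_eq_self: "(\<And>m. m \<in> keys f \<Longrightarrow> P m) \<Longrightarrow> part P f = f"
  by (rule poly_mapping_eqI) (auto simp: lookup_part in_keys_iff)

lemma part_eq_0_iff: "part P f = 0 \<longleftrightarrow> (\<forall>m\<in>keys f. \<not> P m)"
  by (auto simp: keys_part simp flip: keys_eq_empty)

lemma part_add: "part P (f + g) = part P f + part P g"
  by (simp add: part_def monomial_hom_add)

lemma part_0 [simp]: "part P 0 = 0"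
  by (simp add: part_def)

lemma part_diff: "part P (f - g) = part P f - part P (g :: 'm \<Rightarrow>\<^sub>0 'a::comm_ring_1)"
  by (rule poly_mapping_eqI) (auto simp: lookup_part lookup_minus)

lemma part_split: "f = part P f + part (\<lambda>m. \<not> P m) f"
  by (rule poly_mapping_eqI) (auto simp: lookup_part lookup_add)

text \<open>Split each factor into its part of the extremal degree and the rest; every product
  involving a rest lives in degrees above \<open>a + b\<close>. The numbers \<open>a\<close> and
  \<open>b\<close> are mere lower bounds, so either part may be zero.\<close>

lemma part_mult_lowest_degree:
  fixes f g :: "('k::comm_ring_1) mpoly"
  assumes f: "\<And>m. m \<in> keys f \<Longrightarrow> a \<le> mono_deg m" and g: "\<And>m. m \<in> keys g \<Longrightarrow> b \<le> mono_deg m"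
  shows "part (\<lambda>m. mono_deg m = a + b) (f * g) =
    part (\<lambda>m. mono_deg m = a) f * part (\<lambda>m. mono_deg m = b) g"
proof -
  define f0 f1 where f01: "f0 = part (\<lambda>m. mono_deg m = a) f" "f1 = part (\<lambda>m. mono_deg m \<noteq> a) f"
  define g0 g1 where g01: "g0 = part (\<lambda>m. mono_deg m = b) g" "g1 = part (\<lambda>m. mono_deg m \<noteq> b) g"
  have eq: "f = f0 + f1" "g = g0 + g1"
    unfolding f01 g01 by (rule part_split)+
  have deg: "\<And>m. m \<in> keys f0 \<Longrightarrow> mono_deg m = a" "\<And>m. m \<in> keys g0 \<Longrightarrow> mono_deg m = b"
    "\<And>m. m \<in> keys f1 \<Longrightarrow> a < mono_deg m" "\<And>m. m \<in> keys g1 \<Longrightarrow> b < mono_deg m"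
    using f g by (fastforce simp: f01 g01 keys_part)+
  have "f * g = f0 * g0 + (f0 * g1 + (f1 * g0 + f1 * g1))"
    by (simp add: eq algebra_simps)
  moreover have "part (\<lambda>m. mono_deg m = a + b) (f0 * g0) = f0 * g0"
    using keys_mult[of f0 g0] deg by (intro part_eq_self) (auto simp: mono_deg_add)
  moreover have "part (\<lambda>m. mono_deg m = a + b) (f0 * g1) = 0"
    using keys_mult[of f0 g1] deg by (force simp: part_eq_0_iff mono_deg_add)
  moreover have "part (\<lambda>m. mono_deg m = a + b) (f1 * g0) = 0"
    using keys_mult[of f1 g0] deg by (force simp: part_eq_0_iff mono_deg_add)
  moreover have "part (\<lambda>m. mono_deg m = a + b) (f1 * g1) = 0"
    using keys_mult[of f1 g1] deg by (fastforce simp: part_eq_0_iff mono_deg_add)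
  ultimately show ?thesis
    by (simp add: part_add f01 g01)
qed

lemma mono_deg_mult_ge:
  assumes "\<And>m. m \<in> keys f \<Longrightarrow> a \<le> mono_deg m" "\<And>m. m \<in> keys g \<Longrightarrow> b \<le> mono_deg m"
    "m \<in> keys (f * g)"
  shows "a + b \<le> mono_deg m"
proof -
  obtain m1 m2 where "m = m1 + m2" "m1 \<in> keys f" "m2 \<in> keys g"
    using keys_mult[of f g] assms(3) by blast
  then show ?thesis
    using assms(1)[of m1] assms(2)[of m2] by (simp add: mono_deg_add)
qed

lemma mono_deg_power_ge:
  fixes f :: "('k::comm_semiring_1) mpoly"
  assumes "\<And>m. m \<in> keys f \<Longrightarrow> a \<le> mono_deg m" "m \<in> keys (f ^ q)"
  shows "q * a \<le> mono_deg m"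
  using assms(2)
proof (induction q arbitrary: m)
  case (Suc q)
  have "a + q * a \<le> mono_deg m"
    using Suc by (intro mono_deg_mult_ge[OF assms(1)]) auto
  then show ?case by simp
qed simp

lemma part_power_lowest_degree:
  fixes f :: "('k::comm_ring_1) mpoly"
  assumes "\<And>m. m \<in> keys f \<Longrightarrow> a \<le> mono_deg m"
  shows "part (\<lambda>m. mono_deg m = q * a) (f ^ q) = part (\<lambda>m. mono_deg m = a) f ^ q"
proof (induction q)
  case 0
  then show ?case by (auto intro!: part_eq_self simp: mono_deg_def)
next
  case (Suc q)
  have "part (\<lambda>m. mono_deg m = a + q * a) (f * f ^ q) =
      part (\<lambda>m. mono_deg m = a) f * part (\<lambda>m. mono_deg m = q * a) (f ^ q)"
    by (intro part_mult_lowest_degree assms mono_deg_power_ge)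
  then show ?case by (simp add: Suc)
qed

lemma lowest_degree_exists:
  fixes f :: "('k::comm_semiring_1) mpoly"
  assumes "m \<in> keys f"
  obtains a where "a \<le> mono_deg m" "\<And>m. m \<in> keys f \<Longrightarrow> a \<le> mono_deg m"
    "part (\<lambda>m. mono_deg m = a) f \<noteq> 0"
proof
  let ?a = "Min (mono_deg ` keys f)"
  show "?a \<le> mono_deg m" "\<And>m. m \<in> keys f \<Longrightarrow> ?a \<le> mono_deg m"
    using assms by auto
  have "?a \<in> mono_deg ` keys f"
    using assms by (intro Min_in) auto
  then show "part (\<lambda>m. mono_deg m = ?a) f \<noteq> 0"
    by (fastforce simp: part_eq_0_iff)
qed

text \<open>Lowest-degree parts multiply in a domain, so the order of vanishing of \<open>c * f ^ q\<close> at the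
  origin is that of \<open>c\<close> plus \<open>q\<close> times that of \<open>f\<close>; the first summand does not depend on \<open>q\<close>.\<close>

lemma degree_ge_of_power_multiples:
  fixes c f :: "('k::field) mpoly"
  assumes "c \<noteq> 0" "m \<in> keys f"
    and *: "\<And>N. \<exists>q>N. \<forall>u\<in>keys (c * f ^ q). q * s \<le> mono_deg u"
  shows "s \<le> mono_deg m"
proof (rule ccontr)
  assume less: "\<not> s \<le> mono_deg m"
  obtain a where a: "a \<le> mono_deg m" "\<And>m. m \<in> keys f \<Longrightarrow> a \<le> mono_deg m"
    "part (\<lambda>m. mono_deg m = a) f \<noteq> 0"
    using lowest_degree_exists[OF assms(2)] by metis
  obtain m' where "m' \<in> keys c"
    using assms(1) by (metis ex_in_conv keys_eq_empty)
  then obtain b where b: "\<And>m. m \<in> keys c \<Longrightarrow> b \<le> mono_deg m"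
    "part (\<lambda>m. mono_deg m = b) c \<noteq> 0"
    using lowest_degree_exists by metis
  \<comment> \<open>The choice q > b gives b + q a < q (a + 1) \<le> q s, so the surviving
    lowest-degree part contradicts the assumed bound.\<close>
  obtain q where q: "q > b" "\<forall>u\<in>keys (c * f ^ q). q * s \<le> mono_deg u"
    using * by blast
  have "part (\<lambda>m. mono_deg m = b + q * a) (c * f ^ q) =
      part (\<lambda>m. mono_deg m = b) c * part (\<lambda>m. mono_deg m = a) f ^ q"
    by (simp add: part_mult_lowest_degree[OF b(1) mono_deg_power_ge[OF a(2)]]
        part_power_lowest_degree[OF a(2)])
  with a b have "part (\<lambda>m. mono_deg m = b + q * a) (c * f ^ q) \<noteq> 0"
    by simp
  then obtain u where u: "u \<in> keys (c * f ^ q)" "mono_deg u = b + q * a"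
    by (auto simp: part_eq_0_iff)
  have "q * Suc a \<le> q * s"
    using less a(1) by (intro mult_le_mono2) simp
  with q u show False by force
qed

text \<open>Sets the variables outside \<open>F\<close> to zero. Exponents cannot cancel, so the
  support of a product monomial is the union of the supports and the map is multiplicative. Its
  values model k[F] inside the ambient polynomial type, a domain common to all faces.\<close>

definition face_part :: "nat set \<Rightarrow> 'k mpoly \<Rightarrow> ('k::field) mpoly" where
  "face_part F = part (\<lambda>m. keys m \<subseteq> F)"

lemma face_part_mult: "face_part F (f * g) = face_part F f * face_part F g"
  unfolding face_part_def part_def by (rule monomial_hom_mult) (auto simp: keys_add_nat)

lemma face_part_1: "face_part F 1 = 1"
  unfolding face_part_def part_def by (rule monomial_hom_1) auto

lemma face_part_add: "face_part F (f + g) = face_part F f + face_part F g"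
  by (simp add: face_part_def part_add)

text \<open>Pullback along the line \<open>t \<mapsto> t a\<close>, with polynomials in \<open>t\<close> encoded as \<open>nat \<Rightarrow>\<^sub>0 'k\<close>.\<close>

definition line_eval :: "(nat \<Rightarrow> 'k) \<Rightarrow> 'k mpoly \<Rightarrow> nat \<Rightarrow>\<^sub>0 ('k::field)" where
  "line_eval a = monomial_hom mono_deg (\<lambda>m. \<Prod>i\<in>keys m. a i ^ lookup m i)"

lemma line_eval_mult: "line_eval a (f * g) = line_eval a f * line_eval a g"
proof -
  have *: "(\<Prod>i\<in>keys m. a i ^ lookup m i) = (\<Prod>i\<in>S. a i ^ lookup m i)"
    if "finite S" "keys m \<subseteq> S" for m :: "nat \<Rightarrow>\<^sub>0 nat" and S
    using that by (intro prod.mono_neutral_left) (auto simp: in_keys_iff)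
  show ?thesis
    unfolding line_eval_def
  proof (rule monomial_hom_mult)
    fix m m' :: "nat \<Rightarrow>\<^sub>0 nat"
    show "(\<Prod>i\<in>keys (m + m'). a i ^ lookup (m + m') i) =
        (\<Prod>i\<in>keys m. a i ^ lookup m i) * (\<Prod>i\<in>keys m'. a i ^ lookup m' i)"
      by (simp add: *[of "keys m \<union> keys m'"] keys_add_nat lookup_add power_add prod.distrib)
  qed (rule mono_deg_add)
qed

lemma line_eval_1: "line_eval a 1 = 1"
  unfolding line_eval_def by (rule monomial_hom_1) (auto simp: mono_deg_def)

lemma line_eval_add: "line_eval a (f + g) = line_eval a f + line_eval a g"
  by (simp add: line_eval_def monomial_hom_add)

text \<open>Degree 0 is attained by the constant monomial alone, whose weight is an empty product.
  This places the kernel of the pullback inside the irrelevant ideal.\<close>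

lemma lookup_line_eval_0: "lookup (line_eval a f) 0 = lookup f 0"
proof -
  have "lookup (line_eval a f) 0 = (\<Sum>m\<in>keys f. if m = 0 then lookup f m else 0)"
    unfolding line_eval_def monomial_hom_def
    by (auto simp: lookup_sum lookup_single when_def mono_deg_eq_0 intro!: sum.cong)
  then show ?thesis by (auto simp: in_keys_iff)
qed

text \<open>A monomial involving a variable outside \<open>F\<close> takes the value 0 at
  \<open>a\<close>. For a face \<open>F\<close> the pullback therefore kills the Stanley-Reisner
  ideal.\<close>

lemma line_eval_face_part:
  assumes "\<And>i. i \<notin> F \<Longrightarrow> a i = 0"
  shows "line_eval a (face_part F f) = line_eval a f"
proof -
  have "line_eval a (single m c) = 0" if m: "\<not> keys m \<subseteq> F" for m c
  proof -
    obtain i where "i \<in> keys m" "i \<notin> F"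
      using m by blast
    then have "(\<Prod>i\<in>keys m. a i ^ lookup m i) = 0"
      using assms[of i] by (intro prod_zero) (auto simp: in_keys_iff intro!: bexI[of _ i])
    then show ?thesis
      unfolding line_eval_def monomial_hom_single by (simp only: mult_zero_right single_zero)
  qed
  then have "line_eval a (part (\<lambda>m. \<not> keys m \<subseteq> F) f) = 0"
    by (subst sum_single_lookup[symmetric])
       (auto simp: line_eval_def monomial_hom_sum keys_part intro!: sum.neutral)
  then show ?thesis
    by (metis add.right_neutral face_part_def line_eval_add part_split)
qed

lemma single_sum: "single k (sum f S) = (\<Sum>x\<in>S. single k (f x))"
  by (induction S rule: infinite_finite_induct) (auto simp: single_add)

lemma line_eval_linear:
  assumes "homogeneous_poly 1 f"
  shows "line_eval a f = single 1 (\<Sum>m\<in>keys f. lookup f m * (\<Prod>i\<in>keys m. a i ^ lookup m i))"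
  using assms unfolding line_eval_def monomial_hom_def homogeneous_poly_def
  by (simp add: single_sum)

section \<open>The Stanley-Reisner ring\<close>

lemma carrier_poly_ring:
  "f \<in> carrier (poly_ring n) \<longleftrightarrow> (\<forall>m\<in>keys f. keys m \<subseteq> {1..n})"
  by (simp add: poly_ring_def)

lemma poly_ring_simps [simp]:
  "x \<oplus>\<^bsub>poly_ring n\<^esub> y = x + y" "x \<otimes>\<^bsub>poly_ring n\<^esub> y = x * y"
  "\<zero>\<^bsub>poly_ring n\<^esub> = 0" "\<one>\<^bsub>poly_ring n\<^esub> = 1"
  by (simp_all add: poly_ring_def)

lemma poly_ring_closed:
  "f \<in> carrier (poly_ring n) \<Longrightarrow> g \<in> carrier (poly_ring n) \<Longrightarrow> f + g \<in> carrier (poly_ring n)"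
  "f \<in> carrier (poly_ring n) \<Longrightarrow> g \<in> carrier (poly_ring n) \<Longrightarrow> f * g \<in> carrier (poly_ring n)"
  "f \<in> carrier (poly_ring n) \<Longrightarrow> - f \<in> carrier (poly_ring n)"
  "0 \<in> carrier (poly_ring n)" "1 \<in> carrier (poly_ring n)"
proof -
  show "f \<in> carrier (poly_ring n) \<Longrightarrow> g \<in> carrier (poly_ring n) \<Longrightarrow> f + g \<in> carrier (poly_ring n)"
    using keys_add[of f g] unfolding carrier_poly_ring by blast
  show "f * g \<in> carrier (poly_ring n)"
    if f: "f \<in> carrier (poly_ring n)" and g: "g \<in> carrier (poly_ring n)"
    unfolding carrier_poly_ring
  proof
    fix m assume "m \<in> keys (f * g)"
    then obtain a b where "m = a + b" "a \<in> keys f" "b \<in> keys g"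
      using keys_mult[of f g] by blast
    then show "keys m \<subseteq> {1..n}"
      using f g by (simp add: carrier_poly_ring keys_add_nat)
  qed
qed (simp_all add: carrier_poly_ring)

lemma poly_ring_closed_diff:
  "f \<in> carrier (poly_ring n) \<Longrightarrow> g \<in> carrier (poly_ring n) \<Longrightarrow> f - g \<in> carrier (poly_ring n)"
  using poly_ring_closed(1,3) by (metis add_uminus_conv_diff)

lemma poly_ring_closed_power: "f \<in> carrier (poly_ring n) \<Longrightarrow> f ^ q \<in> carrier (poly_ring n)"
  by (induction q) (auto intro: poly_ring_closed)

lemma poly_ring_closed_sum:
  "(\<And>x. x \<in> S \<Longrightarrow> f x \<in> carrier (poly_ring n)) \<Longrightarrow> sum f S \<in> carrier (poly_ring n)"
  by (induction S rule: infinite_finite_induct) (auto intro: poly_ring_closed)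

lemma poly_ring_closed_part: "f \<in> carrier (poly_ring n) \<Longrightarrow> part P f \<in> carrier (poly_ring n)"
  by (simp add: carrier_poly_ring keys_part)

lemma single_in_poly_ring: "keys m \<subseteq> {1..n} \<Longrightarrow> single m c \<in> carrier (poly_ring n)"
  by (simp add: carrier_poly_ring)

lemma poly_var_in_poly_ring: "i \<in> {1..n} \<Longrightarrow> poly_var i \<in> carrier (poly_ring n)"
  by (simp add: poly_var_def single_in_poly_ring)

lemma cring_poly_ring: "cring (poly_ring n)"
proof (rule cringI)
  show "abelian_group (poly_ring n)"
  proof (rule abelian_groupI)
    fix x assume "x \<in> carrier (poly_ring n)"
    then show "\<exists>y\<in>carrier (poly_ring n). y \<oplus>\<^bsub>poly_ring n\<^esub> x = \<zero>\<^bsub>poly_ring n\<^esub>"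
      by (intro bexI[of _ "- x"]) (simp_all add: poly_ring_closed)
  qed (auto simp: poly_ring_closed algebra_simps)
  show "comm_monoid (poly_ring n)"
    by (rule comm_monoidI) (auto simp: poly_ring_closed algebra_simps)
qed (simp add: algebra_simps)

lemma prod_poly_var: "(\<Prod>i\<in>F. poly_var i) = single (\<Sum>i\<in>F. single i 1) 1"
  by (induction F rule: infinite_finite_induct) (auto simp: poly_var_def mult_single)

lemma lookup_sum_single: "finite F \<Longrightarrow> lookup (\<Sum>i\<in>F. single i 1) j = (of_bool (j \<in> F) :: nat)"
  by (simp add: lookup_sum lookup_single when_def of_bool_def)

lemma keys_sum_single: "finite F \<Longrightarrow> keys (\<Sum>i\<in>F. single i (1 :: nat)) = F"
  by (auto simp: in_keys_iff lookup_sum_single simp del: One_nat_def)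

lemma single_eq_prod_poly_var_mult:
  assumes "finite F" "F \<subseteq> keys m"
  shows "single m c = (\<Prod>i\<in>F. poly_var i) * single (m - (\<Sum>i\<in>F. single i 1)) c"
proof -
  have "m = (\<Sum>i\<in>F. single i 1) + (m - (\<Sum>i\<in>F. single i 1))"
    using assms by (intro poly_mapping_eqI) (auto simp: lookup_add lookup_minus lookup_sum_single in_keys_iff simp del: One_nat_def)
  then show ?thesis
    by (simp add: prod_poly_var mult_single)
qed

lemma single_eq_poly_var_mult:
  assumes "i \<in> keys m"
  shows "single m c = poly_var i * single (m - single i 1) c"
  using single_eq_prod_poly_var_mult[of "{i}" m c] assms by simp

lemma keys_diff_nat: "keys (m - m' :: nat \<Rightarrow>\<^sub>0 nat) \<subseteq> keys m"
  by (auto simp: in_keys_iff lookup_minus)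

lemma carrier_FactRing: "carrier (S Quot J) = (+>\<^bsub>S\<^esub>) J ` carrier S"
  by (auto simp: FactRing_def A_RCOSETS_def')

locale stanley_reisner =
  fixes n :: nat and \<Delta> :: "nat set set" and R :: "(('k::field) mpoly set) ring" (structure)
  assumes complex: "simplicial_complex n \<Delta>" and R_def: "R = sr_ring n \<Delta>"
begin

abbreviation A :: "'k mpoly ring" where "A \<equiv> poly_ring n"

definition pr :: "'k mpoly \<Rightarrow> 'k mpoly set" where
  "pr f = sr_ideal n \<Delta> +>\<^bsub>A\<^esub> f"

lemma face_subset: "F \<in> \<Delta> \<Longrightarrow> F \<subseteq> {1..n}"
  and subface: "F \<in> \<Delta> \<Longrightarrow> G \<subseteq> F \<Longrightarrow> G \<in> \<Delta>"
  and empty_face: "{} \<in> \<Delta>"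
  and vertex: "i \<in> {1..n} \<Longrightarrow> {i} \<in> \<Delta>"
  using complex unfolding simplicial_complex_def by blast+

lemma finite_face: "F \<in> \<Delta> \<Longrightarrow> finite F"
  using face_subset finite_subset by blast

lemma finite_complex: "finite \<Delta>"
  by (rule finite_subset[of _ "Pow {1..n}"]) (use face_subset in blast, simp)

lemma ring_A: "ring A"
  using cring_poly_ring by (rule cring.axioms)

text \<open>Multiplication only enlarges the support of a monomial, and a superset of a nonface is a
  nonface.\<close>

lemma ideal_nonface: "ideal {f \<in> carrier A. \<forall>m\<in>keys f. keys m \<notin> \<Delta>} A" (is "ideal ?J A")
proof (rule idealI[OF ring_A])
  interpret A: cring A by (rule cring_poly_ring)
  show "subgroup ?J (add_monoid A)"
  proof (rule A.add.subgroupI)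
    show "?J \<noteq> {}" by (auto intro!: exI[of _ 0] simp: poly_ring_closed)
    fix f assume f: "f \<in> ?J"
    have "\<ominus>\<^bsub>A\<^esub> f = - f"
      using f by (intro A.minus_equality) (auto simp: poly_ring_closed)
    with f show "\<ominus>\<^bsub>A\<^esub> f \<in> ?J" by (simp add: poly_ring_closed)
  next
    fix f g assume "f \<in> ?J" "g \<in> ?J"
    then show "f \<oplus>\<^bsub>A\<^esub> g \<in> ?J"
      using keys_add[of f g] by (auto simp: poly_ring_closed)
  qed (auto simp: poly_ring_closed)
  have *: "f * g \<in> ?J" if "f \<in> ?J" "g \<in> carrier A" for f g
  proof -
    have "keys m \<notin> \<Delta>" if m: "m \<in> keys (f * g)" for m
    proof -
      obtain a b where "m = a + b" "a \<in> keys f"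
        using keys_mult[of f g] m by blast
      then show ?thesis
        using \<open>f \<in> ?J\<close> subface[of "keys m" "keys a"] by (auto simp: keys_add_nat)
    qed
    with that show ?thesis by (simp add: poly_ring_closed)
  qed
  show "g \<otimes>\<^bsub>A\<^esub> f \<in> ?J" "f \<otimes>\<^bsub>A\<^esub> g \<in> ?J" if "f \<in> ?J" "g \<in> carrier A" for f g
    using *[OF that] by (simp_all add: mult.commute)
qed

text \<open>A monomial with nonface support is a multiple of the generator attached to that support.
  Membership thus becomes a condition on each monomial separately, which replaces coset arguments in
  the sequel.\<close>

lemma sr_ideal_eq: "sr_ideal n \<Delta> = {f \<in> carrier A. \<forall>m\<in>keys f. keys m \<notin> \<Delta>}" (is "_ = ?J")
proof
  let ?G = "{\<Prod>i\<in>F. poly_var i | F. F \<subseteq> {1..n} \<and> F \<notin> \<Delta>} :: 'k mpoly set"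
  interpret A: cring A by (rule cring_poly_ring)
  have G: "?G \<subseteq> ?J"
  proof
    fix f assume "f \<in> ?G"
    then obtain F where "f = single (\<Sum>i\<in>F. single i 1) 1" "F \<subseteq> {1..n}" "F \<notin> \<Delta>" "finite F"
      using finite_subset by (auto simp: prod_poly_var)
    then show "f \<in> ?J"
      by (simp add: carrier_poly_ring keys_sum_single del: One_nat_def)
  qed
  then show "sr_ideal n \<Delta> \<subseteq> ?J"
    unfolding sr_ideal_def by (rule A.genideal_minimal[OF ideal_nonface])
  have "?G \<subseteq> carrier A" using G by blast
  then interpret I: ideal "sr_ideal n \<Delta>" A
    unfolding sr_ideal_def by (rule A.genideal_ideal)
  show "?J \<subseteq> sr_ideal n \<Delta>"
  proof
    fix f assume f: "f \<in> ?J"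
    have "single m (lookup f m) \<in> sr_ideal n \<Delta>" if m: "m \<in> keys f" for m
    proof -
      have "(\<Prod>i\<in>keys m. poly_var i) \<in> (sr_ideal n \<Delta> :: 'k mpoly set)"
        unfolding sr_ideal_def using f m
        by (intro subsetD[OF A.genideal_self[OF \<open>?G \<subseteq> carrier A\<close>]]) (auto simp: carrier_poly_ring)
      moreover have "single (m - (\<Sum>i\<in>keys m. single i 1)) (lookup f m) \<in> carrier A"
        using f m keys_diff_nat[of m] by (intro single_in_poly_ring) (auto simp: carrier_poly_ring)
      ultimately show ?thesis
        using I.I_r_closed by (subst single_eq_prod_poly_var_mult[of "keys m"]) auto
    qed
    then have "(\<Sum>m\<in>S. single m (lookup f m)) \<in> sr_ideal n \<Delta>" if "S \<subseteq> keys f" for S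
      using that
    proof (induction S rule: infinite_finite_induct)
      case (insert x F)
      then show ?case using I.a_closed by simp
    qed (use I.zero_closed in auto)
    then show "f \<in> sr_ideal n \<Delta>"
      by (metis order_refl sum_single_lookup)
  qed
qed

lemma ideal_sr_ideal: "ideal (sr_ideal n \<Delta>) A"
  unfolding sr_ideal_eq by (rule ideal_nonface)

lemma ring_hom_pr: "ring_hom_cring A R pr"
  using ideal.rcos_ring_hom_cring[OF ideal_sr_ideal cring_poly_ring]
  unfolding R_def sr_ring_def pr_def .

sublocale cring R
  using ring_hom_pr by (rule ring_hom_cring.axioms)

sublocale pr: ring_hom_cring A R pr
  by (rule ring_hom_pr)

lemma carrier_R: "carrier R = pr ` carrier A"
  by (auto simp: R_def sr_ring_def carrier_FactRing pr_def)

lemma pr_simps: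
  "f \<in> carrier A \<Longrightarrow> g \<in> carrier A \<Longrightarrow> pr (f + g) = pr f \<oplus> pr g"
  "f \<in> carrier A \<Longrightarrow> g \<in> carrier A \<Longrightarrow> pr (f * g) = pr f \<otimes> pr g"
  "pr 1 = \<one>" "pr 0 = \<zero>"
  using pr.hom_add pr.hom_mult pr.hom_one pr.hom_zero by auto

lemma pr_closed: "f \<in> carrier A \<Longrightarrow> pr f \<in> carrier R"
  by (rule pr.hom_closed)

lemma pr_power: "f \<in> carrier A \<Longrightarrow> pr (f ^ q) = pr f [^] q"
  by (induction q) (auto simp: pr_simps poly_ring_closed poly_ring_closed_power m_comm pr_closed)

lemma pr_diff: "f \<in> carrier A \<Longrightarrow> g \<in> carrier A \<Longrightarrow> pr (f - g) = pr f \<ominus> pr g"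
  using pr_simps(1)[of "f - g" g]
  by (simp add: poly_ring_closed_diff pr_closed a_minus_def a_assoc r_neg)

lemma pr_eq_0_iff: "f \<in> carrier A \<Longrightarrow> pr f = \<zero> \<longleftrightarrow> f \<in> sr_ideal n \<Delta>"
  using ring.quotient_eq_iff_same_a_r_cos[OF ring_A ideal_sr_ideal, of f 0]
  by (simp add: pr_def[symmetric] pr_simps poly_ring_closed a_minus_def ring.minus_zero[OF ring_A, simplified])

lemma pr_eq_iff:
  assumes "f \<in> carrier A" "g \<in> carrier A"
  shows "pr f = pr g \<longleftrightarrow> f - g \<in> sr_ideal n \<Delta>"
  using pr_eq_0_iff[of "f - g"] assms
  by (simp add: poly_ring_closed_diff pr_diff pr_closed)

lemma pr_mem_ideal_sum:
  assumes "ideal J R" "\<And>x. x \<in> S \<Longrightarrow> f x \<in> carrier A" "\<And>x. x \<in> S \<Longrightarrow> pr (f x) \<in> J"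
  shows "pr (sum f S) \<in> J"
proof -
  interpret J: ideal J R by fact
  show ?thesis
    using assms(2,3)
    by (induction S rule: infinite_finite_induct)
      (auto simp: pr_simps poly_ring_closed_sum J.a_closed J.zero_closed)
qed

lemma pr_mem_ideal:
  assumes "ideal J R" "f \<in> carrier A" "\<And>m. m \<in> keys f \<Longrightarrow> pr (single m (lookup f m)) \<in> J"
  shows "pr f \<in> J"
  using pr_mem_ideal_sum[of J "keys f" "\<lambda>m. single m (lookup f m)"] assms
  by (simp add: sum_single_lookup carrier_poly_ring)

lemma single_poly_var_mult_mem_ideal:
  assumes "ideal J R" "i \<in> keys m" "keys m \<subseteq> {1..n}" "pr (poly_var i) \<in> J"
  shows "pr (single m c) \<in> J"
proof -
  interpret J: ideal J R by fact
  have c: "poly_var i \<in> carrier A" "single (m - single i 1) c \<in> carrier A"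
    using assms keys_diff_nat[of m "single i 1"]
    by (blast intro: poly_var_in_poly_ring single_in_poly_ring)+
  then show ?thesis
    by (simp add: single_eq_poly_var_mult[OF assms(2)] pr_simps pr_closed J.I_r_closed assms(4))
qed

section \<open>Homomorphisms from the Stanley-Reisner ring to domains\<close>

definition descend :: "('k mpoly \<Rightarrow> 'b) \<Rightarrow> 'k mpoly set \<Rightarrow> 'b" where
  "descend h x = h (SOME f. f \<in> carrier A \<and> pr f = x)"

context
  fixes h :: "'k mpoly \<Rightarrow> 'b::idom"
  assumes h: "\<And>f g. h (f + g) = h f + h g" "\<And>f g. h (f * g) = h f * h g" "h 1 = 1"
    and kills: "\<And>f. f \<in> sr_ideal n \<Delta> \<Longrightarrow> h f = 0"
begin

text \<open>Two representatives of a coset differ by an element of the Stanley-Reisner ideal, which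
  \<open>h\<close> kills; the arbitrary choice in \<open>descend\<close> is therefore
  harmless.\<close>

lemma descend_pr: "f \<in> carrier A \<Longrightarrow> descend h (pr f) = h f"
proof -
  assume f: "f \<in> carrier A"
  define g where "g = (SOME g. g \<in> carrier A \<and> pr g = pr f)"
  have g: "g \<in> carrier A \<and> pr g = pr f"
    unfolding g_def by (rule someI[of _ f]) (use f in auto)
  then have "h (g - f) = 0"
    using f by (intro kills) (simp flip: pr_eq_iff)
  then have "h g = h f"
    using h(1)[of "g - f" f] by simp
  then show ?thesis by (simp add: descend_def g_def)
qed

lemma descend_simps:
  "x \<in> carrier R \<Longrightarrow> y \<in> carrier R \<Longrightarrow> descend h (x \<oplus> y) = descend h x + descend h y"
  "x \<in> carrier R \<Longrightarrow> y \<in> carrier R \<Longrightarrow> descend h (x \<otimes> y) = descend h x * descend h y"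
  "descend h \<one> = 1" "descend h \<zero> = 0"
proof -
  show "descend h \<one> = 1"
    using descend_pr[of 1] h by (simp add: poly_ring_closed pr_simps)
  show "descend h \<zero> = 0"
    using descend_pr[of 0] kills[of 0] by (simp add: poly_ring_closed pr_simps sr_ideal_eq)
  assume "x \<in> carrier R" "y \<in> carrier R"
  then obtain f g where "f \<in> carrier A" "g \<in> carrier A" "x = pr f" "y = pr g"
    by (auto simp: carrier_R)
  then show "descend h (x \<oplus> y) = descend h x + descend h y"
    "descend h (x \<otimes> y) = descend h x * descend h y"
    by (simp_all add: h descend_pr poly_ring_closed flip: pr_simps)
qed

lemma descend_power: "x \<in> carrier R \<Longrightarrow> descend h (x [^] (q :: nat)) = descend h x ^ q"
  by (induction q) (auto simp: descend_simps)

text \<open>The kernel of a homomorphism into a domain. Both the primes of faces and the prime of a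
  line arise this way.\<close>

lemma primeideal_descend: "primeideal {x \<in> carrier R. descend h x = 0} R" (is "primeideal ?K R")
proof (rule primeidealI)
  show "ideal ?K R"
  proof (rule idealI)
    show "subgroup ?K (add_monoid R)"
    proof (rule add.subgroupI)
      show "\<ominus> x \<in> ?K" if "x \<in> ?K" for x
        using that descend_simps(1)[of x "\<ominus> x"] by (simp add: r_neg descend_simps)
    qed (auto simp: descend_simps intro!: exI[of _ \<zero>])
  qed (auto simp: descend_simps ring_axioms)
  show "carrier R \<noteq> ?K"
    by (metis (mono_tags, lifting) descend_simps(3) mem_Collect_eq one_closed zero_neq_one)
qed (auto simp: descend_simps is_cring)

end

end

section \<open>Minimal primes\<close>

context stanley_reisner
begin

lemma face_part_kills: "F \<in> \<Delta> \<Longrightarrow> f \<in> sr_ideal n \<Delta> \<Longrightarrow> face_part F (f :: 'k mpoly) = 0"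
  using subface by (auto simp: face_part_def part_eq_0_iff sr_ideal_eq)

text \<open>The quotient map from R onto k[F], meaningful when \<open>F\<close> is a face.\<close>

definition rho :: "nat set \<Rightarrow> 'k mpoly set \<Rightarrow> 'k mpoly" where
  "rho F = descend (face_part F)"

context
  fixes F assumes F: "F \<in> \<Delta>"
begin

lemmas rho_pr = descend_pr[OF face_part_add face_part_mult face_part_1 face_part_kills[OF F],
    folded rho_def, simplified]
lemmas rho_simps = descend_simps[OF face_part_add face_part_mult face_part_1 face_part_kills[OF F],
    folded rho_def, simplified]
lemmas rho_power = descend_power[OF face_part_add face_part_mult face_part_1 face_part_kills[OF F],
    folded rho_def, simplified]
lemmas primeideal_rho =
  primeideal_descend[OF face_part_add face_part_mult face_part_1 face_part_kills[OF F],
    folded rho_def, simplified]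

end

definition face_prime :: "nat set \<Rightarrow> 'k mpoly set set" where
  "face_prime F = {x \<in> carrier R. rho F x = 0}"

definition facets :: "nat set set" where
  "facets = {F \<in> \<Delta>. \<forall>G\<in>\<Delta>. F \<subseteq> G \<longrightarrow> G = F}"

lemma facets_subset: "F \<in> facets \<Longrightarrow> F \<in> \<Delta>"
  by (simp add: facets_def)

lemma finite_facets: "finite facets"
  using finite_complex by (simp add: facets_def)

lemma facet_above: "G \<in> \<Delta> \<Longrightarrow> \<exists>F\<in>facets. G \<subseteq> F"
  using finite_has_maximal2[OF finite_complex, of G] by (auto simp: facets_def)

lemma primeideal_face_prime: "F \<in> \<Delta> \<Longrightarrow> primeideal (face_prime F) R"
  unfolding face_prime_def by (rule primeideal_rho)

lemma pr_mem_face_prime: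
  assumes "F \<in> \<Delta>" "f \<in> carrier A"
  shows "pr f \<in> face_prime F \<longleftrightarrow> (\<forall>m\<in>keys f. \<not> keys m \<subseteq> F)"
  using assms by (simp add: face_prime_def rho_pr pr_closed face_part_def part_eq_0_iff)

lemma face_prime_mono:
  assumes "F \<subseteq> G" "G \<in> \<Delta>"
  shows "face_prime G \<subseteq> face_prime F"
proof
  fix x assume x: "x \<in> face_prime G"
  then obtain f where "x = pr f" "f \<in> carrier A"
    by (auto simp: face_prime_def carrier_R)
  with x assms subface[of G F] show "x \<in> face_prime F"
    by (auto simp: pr_mem_face_prime)
qed

lemma poly_var_mem_face_prime:
  "F \<in> \<Delta> \<Longrightarrow> i \<in> {1..n} \<Longrightarrow> pr (poly_var i) \<in> face_prime F \<longleftrightarrow> i \<notin> F"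
  by (simp add: pr_mem_face_prime poly_var_in_poly_ring) (simp add: poly_var_def)

lemma prod_poly_var_in_poly_ring: "F \<subseteq> {1..n} \<Longrightarrow> (\<Prod>i\<in>F. poly_var i) \<in> carrier A"
  by (induction F rule: infinite_finite_induct)
    (auto intro!: poly_ring_closed poly_var_in_poly_ring)

text \<open>\<open>F\<close> is the set of variables outside \<open>Q\<close>. Their product is
  outside \<open>Q\<close> by primality, hence nonzero in R, so \<open>F\<close> is a face. A
  monomial not supported on \<open>F\<close> contains a variable lying in \<open>Q\<close>, which
  puts the kernel of restriction to \<open>F\<close> inside \<open>Q\<close>.\<close>

lemma primeideal_contains_face_prime:
  assumes "primeideal Q R"
  obtains F where "F \<in> \<Delta>" "face_prime F \<subseteq> Q" "\<And>i. i \<in> F \<Longrightarrow> pr (poly_var i) \<notin> Q"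
proof
  interpret Q: primeideal Q R by fact
  define F where "F = {i \<in> {1..n}. pr (poly_var i) \<notin> Q}"
  show "pr (poly_var i) \<notin> Q" if "i \<in> F" for i
    using that by (simp add: F_def)
  have F_sub: "F \<subseteq> {1..n}" by (auto simp: F_def)
  have "pr (\<Prod>i\<in>G. poly_var i) \<notin> Q" if "finite G" "G \<subseteq> F" for G
    using that
  proof (induction G rule: finite_induct)
    case empty
    show ?case using Q.one_imp_carrier Q.I_notcarr by (auto simp: pr_simps)
  next
    case (insert i G)
    then have c: "poly_var i \<in> carrier A" "(\<Prod>i\<in>G. poly_var i) \<in> carrier A"
      using F_sub by (blast intro: poly_var_in_poly_ring prod_poly_var_in_poly_ring)+
    have "pr (poly_var i) \<notin> Q" using insert by (simp add: F_def)
    with insert c Q.I_prime[OF pr_closed pr_closed, of "poly_var i" "\<Prod>i\<in>G. poly_var i"]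
    show ?case by (auto simp: pr_simps)
  qed
  moreover have fin: "finite F" using F_sub finite_subset by blast
  ultimately have "pr (\<Prod>i\<in>F. poly_var i) \<noteq> \<zero>"
    using Q.zero_closed by fastforce
  then show "F \<in> \<Delta>"
    using F_sub fin by (auto simp: pr_eq_0_iff prod_poly_var_in_poly_ring sr_ideal_eq)
      (auto simp: prod_poly_var keys_sum_single simp del: One_nat_def)
  show "face_prime F \<subseteq> Q"
  proof
    fix x assume x: "x \<in> face_prime F"
    then obtain f where f: "x = pr f" "f \<in> carrier A"
      by (auto simp: face_prime_def carrier_R)
    show "x \<in> Q"
      unfolding f(1)
    proof (rule pr_mem_ideal[OF Q.is_ideal f(2)])
      fix m assume m: "m \<in> keys f"
      then obtain i where i: "i \<in> keys m" "i \<notin> F"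
        using x f \<open>F \<in> \<Delta>\<close> by (auto simp: pr_mem_face_prime)
      have "keys m \<subseteq> {1..n}" using m f by (simp add: carrier_poly_ring)
      moreover from this have "pr (poly_var i) \<in> Q" using i by (auto simp: F_def)
      ultimately show "pr (single m (lookup f m)) \<in> Q"
        by (intro single_poly_var_mult_mem_ideal[OF Q.is_ideal i(1)])
    qed
  qed
qed

text \<open>Every prime contains a face prime, and face primes shrink as the face grows, so a
  minimal prime belongs to a facet. Conversely, if the face prime of G lies in that of a facet F,
  the variables of F lie outside both, whence F \<subseteq> G and F = G.\<close>

lemma minimal_prime_iff: "minimal_prime R Q \<longleftrightarrow> (\<exists>F\<in>facets. Q = face_prime F)"
proof
  assume Q: "minimal_prime R Q"
  then obtain G where G: "G \<in> \<Delta>" "face_prime G \<subseteq> Q"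
    using primeideal_contains_face_prime unfolding minimal_prime_def by metis
  then obtain F where F: "F \<in> facets" "G \<subseteq> F"
    using facet_above by blast
  then have "face_prime F \<subseteq> Q"
    using face_prime_mono facets_subset G by blast
  then show "\<exists>F\<in>facets. Q = face_prime F"
    using Q F primeideal_face_prime facets_subset unfolding minimal_prime_def by metis
next
  assume "\<exists>F\<in>facets. Q = face_prime F"
  then obtain F where F: "F \<in> facets" "Q = face_prime F" by blast
  show "minimal_prime R Q"
    unfolding minimal_prime_def
  proof (intro conjI allI impI)
    show "primeideal Q R"
      using F facets_subset primeideal_face_prime by simp
    fix Q' assume Q': "primeideal Q' R \<and> Q' \<subseteq> Q"
    then obtain G where G: "G \<in> \<Delta>" "face_prime G \<subseteq> Q'"
      using primeideal_contains_face_prime by metis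
    have "F \<subseteq> G"
    proof
      fix i assume i: "i \<in> F"
      then have "i \<in> {1..n}" using F facets_subset face_subset by blast
      then show "i \<in> G"
        using i F G Q' poly_var_mem_face_prime[of F i] poly_var_mem_face_prime[of G i] facets_subset
        by blast
    qed
    then have "F = G" using F G by (auto simp: facets_def)
    then show "Q' = Q" using F G Q' by blast
  qed
qed

text \<open>Every monomial of \<open>f - g\<close> involves a variable outside \<open>F\<close>.
  Multiplied by x_F, its support strictly contains the facet \<open>F\<close>, so it is a nonface
  and the product vanishes in R.\<close>

lemma facet_prod_mult_eq:
  assumes F: "F \<in> facets" and "x \<in> carrier R" "y \<in> carrier R" "rho F x = rho F y"
  shows "pr (\<Prod>i\<in>F. poly_var i) \<otimes> x = pr (\<Prod>i\<in>F. poly_var i) \<otimes> y"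
proof -
  obtain f g where fg: "x = pr f" "f \<in> carrier A" "y = pr g" "g \<in> carrier A"
    using assms by (auto simp: carrier_R)
  have F': "F \<in> \<Delta>" "F \<subseteq> {1..n}" "finite F"
    using F facets_subset face_subset finite_face by blast+
  let ?x = "\<Prod>i\<in>F. poly_var i :: 'k mpoly"
  have x: "?x \<in> carrier A" by (rule prod_poly_var_in_poly_ring) fact
  have "face_part F (f - g) = 0"
    using assms F' fg by (simp add: rho_pr face_part_def part_diff)
  then have *: "\<not> keys m \<subseteq> F" if "m \<in> keys (f - g)" for m
    using that by (simp add: face_part_def part_eq_0_iff)
  have "keys m \<notin> \<Delta>" if m: "m \<in> keys (?x * (f - g))" for m
  proof -
    obtain m' where m': "m = (\<Sum>i\<in>F. single i 1) + m'" "m' \<in> keys (f - g)"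
      using keys_mult[of ?x "f - g"] m by (auto simp: prod_poly_var)
    then have "keys m = F \<union> keys m'"
      using F' by (simp add: keys_add_nat keys_sum_single del: One_nat_def)
    then show ?thesis
      using F *[OF m'(2)] by (auto simp: facets_def)
  qed
  then have "?x * f - ?x * g \<in> sr_ideal n \<Delta>"
    using x fg by (simp add: sr_ideal_eq right_diff_distrib[symmetric] poly_ring_closed
        poly_ring_closed_diff)
  then have "pr (?x * f) = pr (?x * g)"
    using x fg by (simp add: pr_eq_iff poly_ring_closed)
  then show ?thesis
    using x fg by (simp add: pr_simps)
qed

text \<open>One multiplier for every ideal, every element and every exponent q.\<close>

definition test_poly :: "'k mpoly" where
  "test_poly = (\<Sum>F\<in>facets. \<Prod>i\<in>F. poly_var i)"

lemma prod_facet_in_poly_ring: "F \<in> facets \<Longrightarrow> (\<Prod>i\<in>F. poly_var i) \<in> carrier A"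
  using facets_subset face_subset prod_poly_var_in_poly_ring by blast

lemma test_poly_in_poly_ring: "test_poly \<in> carrier A"
  unfolding test_poly_def by (intro poly_ring_closed_sum prod_facet_in_poly_ring)

text \<open>Distinct facets contribute distinct monomials, so x_F occurs with coefficient exactly 1
  and nothing cancels, whatever the characteristic.\<close>

lemma test_poly_notin_minimal_prime:
  assumes "minimal_prime R Q"
  shows "pr test_poly \<notin> Q"
proof -
  obtain F where F: "F \<in> facets" "Q = face_prime F"
    using assms minimal_prime_iff by blast
  let ?m = "\<Sum>i\<in>F. single i (1 :: nat)"
  have eq: "(\<Sum>i\<in>G. single i (1 :: nat)) = ?m \<longleftrightarrow> G = F" if "G \<in> facets" for G
    using keys_sum_single[of F] keys_sum_single[of G] that F finite_face facets_subset by metis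
  have "lookup test_poly ?m = (\<Sum>G\<in>facets. of_bool (G = F))"
    unfolding test_poly_def lookup_sum
    by (intro sum.cong) (simp_all add: prod_poly_var lookup_single when_def eq of_bool_def del: One_nat_def)
  also have "\<dots> = 1"
    using F finite_facets by (simp add: of_bool_def)
  finally have "?m \<in> keys test_poly"
    by (simp add: in_keys_iff)
  moreover have "keys ?m \<subseteq> F"
    using F finite_face facets_subset by (simp add: keys_sum_single del: One_nat_def)
  ultimately show ?thesis
    using F facets_subset pr_mem_face_prime[OF _ test_poly_in_poly_ring] by blast
qed

lemma test_poly_mult_mem_ideal:
  assumes "ideal L R" "z \<in> carrier R" "\<And>F. F \<in> facets \<Longrightarrow> pr (\<Prod>i\<in>F. poly_var i) \<otimes> z \<in> L"
  shows "pr test_poly \<otimes> z \<in> L"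
proof -
  obtain f where f: "z = pr f" "f \<in> carrier A"
    using assms by (auto simp: carrier_R)
  have "pr (\<Sum>F\<in>facets. (\<Prod>i\<in>F. poly_var i) * f) \<in> L"
    using assms f by (intro pr_mem_ideal_sum)
      (auto simp: poly_ring_closed prod_facet_in_poly_ring pr_simps)
  then show ?thesis
    using f by (simp add: test_poly_def test_poly_in_poly_ring[unfolded test_poly_def]
        flip: pr_simps sum_distrib_right)
qed

section \<open>Powers of the maximal homogeneous ideal\<close>

text \<open>A description of m^s by degrees of representatives, with \<open>mpow 0\<close> the whole
  ring; \<open>pow_ideals_set\<close> identifies it with the power taken in the monoid of
  ideals.\<close>

definition mpow :: "nat \<Rightarrow> 'k mpoly set set" where
  "mpow s = {pr f | f. f \<in> carrier A \<and> (\<forall>m\<in>keys f. s \<le> mono_deg m)}"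

lemma mpowI: "f \<in> carrier A \<Longrightarrow> (\<And>m. m \<in> keys f \<Longrightarrow> s \<le> mono_deg m) \<Longrightarrow> pr f \<in> mpow s"
  unfolding mpow_def by blast

lemma mpowE:
  assumes "x \<in> mpow s"
  obtains f where "x = pr f" "f \<in> carrier A" "\<And>m. m \<in> keys f \<Longrightarrow> s \<le> mono_deg m"
  using assms unfolding mpow_def by blast

lemma pr_mem_mpow:
  assumes f: "f \<in> carrier A"
  shows "pr f \<in> mpow s \<longleftrightarrow> (\<forall>m\<in>keys f. keys m \<in> \<Delta> \<longrightarrow> s \<le> mono_deg m)"
proof (intro iffI ballI impI)
  fix m assume m: "m \<in> keys f" "keys m \<in> \<Delta>" and "pr f \<in> mpow s"
  then obtain g where g: "pr f = pr g" "g \<in> carrier A" "\<And>m. m \<in> keys g \<Longrightarrow> s \<le> mono_deg m"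
    by (auto elim: mpowE)
  then have "f - g \<in> sr_ideal n \<Delta>" using f by (simp add: pr_eq_iff)
  then have "m \<notin> keys (f - g)" using m by (auto simp: sr_ideal_eq)
  then have "m \<in> keys g" using m by (simp add: in_keys_iff lookup_minus)
  then show "s \<le> mono_deg m" by (rule g)
next
  assume *: "\<forall>m\<in>keys f. keys m \<in> \<Delta> \<longrightarrow> s \<le> mono_deg m"
  let ?g = "part (\<lambda>m. keys m \<in> \<Delta>) f"
  have "f - ?g \<in> sr_ideal n \<Delta>"
    using f by (auto simp: sr_ideal_eq poly_ring_closed_diff poly_ring_closed_part in_keys_iff
        lookup_minus lookup_part)
  then have "pr f = pr ?g"
    using f by (simp add: pr_eq_iff poly_ring_closed_part)
  also have "\<dots> \<in> mpow s"
    using * f by (intro mpowI poly_ring_closed_part) (auto simp: keys_part)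
  finally show "pr f \<in> mpow s" .
qed

lemma ideal_mpow: "ideal (mpow s) R"
proof (rule idealI[OF ring_axioms])
  have mult: "x \<otimes> y \<in> mpow s" if x: "x \<in> mpow s" and y: "y \<in> carrier R" for x y
  proof -
    obtain f where f: "x = pr f" "f \<in> carrier A" "\<And>m. m \<in> keys f \<Longrightarrow> s \<le> mono_deg m"
      using x by (metis mpowE)
    obtain g where g: "y = pr g" "g \<in> carrier A"
      using y by (auto simp: carrier_R)
    have "pr (f * g) \<in> mpow s"
      using mono_deg_mult_ge[of f s g 0] f g by (intro mpowI poly_ring_closed) auto
    then show ?thesis using f g by (simp add: pr_simps)
  qed
  have sub: "mpow s \<subseteq> carrier R"
    by (auto simp: pr_closed elim: mpowE)
  show "subgroup (mpow s) (add_monoid R)"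
  proof (rule add.subgroupI[OF sub])
    have "pr 0 \<in> mpow s" by (rule mpowI) (auto simp: poly_ring_closed)
    then show "mpow s \<noteq> {}" by blast
    fix x assume x: "x \<in> mpow s"
    then show "\<ominus> x \<in> mpow s"
      using mult[of x "\<ominus> \<one>"] sub by (auto simp: r_minus)
    fix y assume "y \<in> mpow s"
    with x obtain f g where fg: "x = pr f" "y = pr g" "f \<in> carrier A" "g \<in> carrier A"
      "\<And>m. m \<in> keys f \<Longrightarrow> s \<le> mono_deg m" "\<And>m. m \<in> keys g \<Longrightarrow> s \<le> mono_deg m"
      by (metis mpowE)
    then have "pr (f + g) \<in> mpow s"
      using keys_add[of f g] by (intro mpowI poly_ring_closed) (simp_all, blast)
    then show "x \<oplus> y \<in> mpow s" using fg by (simp add: pr_simps)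
  qed
  fix x y assume "x \<in> mpow s" "y \<in> carrier R"
  then show "x \<otimes> y \<in> mpow s" "y \<otimes> x \<in> mpow s"
    using mult[of x y] sub m_comm[of x y] by auto
qed

lemma mpow_closed: "x \<in> mpow s \<Longrightarrow> x \<in> carrier R"
  by (auto simp: pr_closed elim: mpowE)

lemma mpow_0: "mpow 0 = carrier R"
  by (auto simp: carrier_R mpow_def)

lemma mpow_mult:
  assumes "x \<in> mpow s" "y \<in> mpow t"
  shows "x \<otimes> y \<in> mpow (s + t)"
proof -
  obtain f where f: "x = pr f" "f \<in> carrier A" "\<And>m. m \<in> keys f \<Longrightarrow> s \<le> mono_deg m"
    using assms(1) by (metis mpowE)
  obtain g where g: "y = pr g" "g \<in> carrier A" "\<And>m. m \<in> keys g \<Longrightarrow> t \<le> mono_deg m"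
    using assms(2) by (metis mpowE)
  have "pr (f * g) \<in> mpow (s + t)"
    using mono_deg_mult_ge[of f s g t] f g by (intro mpowI poly_ring_closed) auto
  then show ?thesis using f g by (simp add: pr_simps)
qed

lemma mpow_power:
  assumes "x \<in> mpow s"
  shows "x [^] (q :: nat) \<in> mpow (q * s)"
proof (induction q)
  case (Suc q)
  then show ?case using mpow_mult[OF Suc assms] by (simp add: add.commute)
qed (simp add: mpow_0)

lemma poly_var_mem_mpow: "i \<in> {1..n} \<Longrightarrow> pr (poly_var i) \<in> mpow 1"
  by (rule mpowI[OF poly_var_in_poly_ring]) (auto simp: poly_var_def mono_deg_single)

lemma mpow_1_eq_genideal: "mpow 1 = Idl (pr ` poly_var ` {1..n})"
proof
  let ?S = "pr ` poly_var ` {1..n}"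
  have S: "?S \<subseteq> mpow 1" using poly_var_mem_mpow by blast
  then show "Idl ?S \<subseteq> mpow 1" by (rule genideal_minimal[OF ideal_mpow])
  have S': "?S \<subseteq> carrier R" using S mpow_closed by blast
  then have id: "ideal (Idl ?S) R" by (rule genideal_ideal)
  show "mpow 1 \<subseteq> Idl ?S"
  proof
    fix x assume "x \<in> mpow 1"
    then obtain f where f: "x = pr f" "f \<in> carrier A" "\<And>m. m \<in> keys f \<Longrightarrow> 1 \<le> mono_deg m"
      by (metis mpowE)
    show "x \<in> Idl ?S"
      unfolding f(1)
    proof (rule pr_mem_ideal[OF id f(2)])
      fix m assume m: "m \<in> keys f"
      then have "m \<noteq> 0" using f(3)[of m] by (auto simp: mono_deg_def)
      then obtain i where i: "i \<in> keys m" by (metis ex_in_conv keys_eq_empty)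
      have km: "keys m \<subseteq> {1..n}" using m f by (simp add: carrier_poly_ring)
      have "pr (poly_var i) \<in> Idl ?S" using genideal_self[OF S'] i km by blast
      then show "pr (single m (lookup f m)) \<in> Idl ?S"
        using single_poly_var_mult_mem_ideal[OF id i km] by simp
    qed
  qed
qed

text \<open>For the inclusion from left to right, each monomial of degree at least s + 1 sheds one
  variable and keeps degree at least s.\<close>

lemma mpow_Suc: "mpow (Suc s) = mpow s \<cdot> mpow 1"
proof
  show "mpow s \<cdot> mpow 1 \<subseteq> mpow (Suc s)"
  proof
    interpret M: ideal "mpow (Suc s)" R by (rule ideal_mpow)
    fix x assume "x \<in> mpow s \<cdot> mpow 1"
    then show "x \<in> mpow (Suc s)"
    proof induction
      case (prod i j)
      then show ?case using mpow_mult[of i s j 1] by simp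
    qed (rule M.a_closed)
  qed
  have id: "ideal (mpow s \<cdot> mpow 1) R" by (intro ideal_prod_is_ideal ideal_mpow)
  show "mpow (Suc s) \<subseteq> mpow s \<cdot> mpow 1"
  proof
    fix x assume "x \<in> mpow (Suc s)"
    then obtain f where f: "x = pr f" "f \<in> carrier A" "\<And>m. m \<in> keys f \<Longrightarrow> Suc s \<le> mono_deg m"
      by (metis mpowE)
    show "x \<in> mpow s \<cdot> mpow 1"
      unfolding f(1)
    proof (rule pr_mem_ideal[OF id f(2)])
      fix m assume m: "m \<in> keys f"
      then have "m \<noteq> 0" using f(3)[of m] by (auto simp: mono_deg_def)
      then obtain i where i: "i \<in> keys m" by (metis ex_in_conv keys_eq_empty)
      have km: "keys m \<subseteq> {1..n}" using m f by (simp add: carrier_poly_ring)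
      let ?g = "single (m - single i 1) (lookup f m)"
      have "m = single i 1 + (m - single i 1)"
        using i by (intro poly_mapping_eqI)
          (auto simp: lookup_add lookup_minus lookup_single when_def in_keys_iff)
      then have "mono_deg m = 1 + mono_deg (m - single i 1)"
        by (metis mono_deg_add mono_deg_single)
      then have "s \<le> mono_deg (m - single i 1)"
        using f(3)[OF m] by simp
      moreover have g: "?g \<in> carrier A"
        using km keys_diff_nat[of m "single i 1"] by (blast intro: single_in_poly_ring)
      ultimately have "pr ?g \<in> mpow s"
        by (intro mpowI) (auto split: if_splits)
      moreover have "pr (poly_var i) \<in> mpow 1"
        using i km by (intro poly_var_mem_mpow) blast
      ultimately have "pr ?g \<otimes> pr (poly_var i) \<in> mpow s \<cdot> mpow 1"
        by (rule ideal_prod.prod)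
      moreover have "poly_var i \<in> carrier A"
        using i km by (intro poly_var_in_poly_ring) blast
      ultimately show "pr (single m (lookup f m)) \<in> mpow s \<cdot> mpow 1"
        using g by (simp add: single_eq_poly_var_mult[OF i] mult.commute[of "poly_var i"] pr_simps
            del: One_nat_def)
    qed
  qed
qed

lemma ideals_set_simps [simp]:
  "carrier (ideals_set R) = {I. ideal I R}" "\<one>\<^bsub>ideals_set R\<^esub> = carrier R"
  "I \<otimes>\<^bsub>ideals_set R\<^esub> J = I \<cdot> J"
  by (simp_all add: ideals_set_def)

lemma nat_pow_ideals_set:
  "I [^]\<^bsub>ideals_set R\<^esub> (0 :: nat) = carrier R"
  "I [^]\<^bsub>ideals_set R\<^esub> Suc s = (I [^]\<^bsub>ideals_set R\<^esub> s) \<cdot> I"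
  by (simp_all add: nat_pow_def)

lemma pow_ideals_set: "mpow 1 [^]\<^bsub>ideals_set R\<^esub> s = mpow s"
proof (induction s)
  case (Suc s)
  then show ?case by (simp only: nat_pow_ideals_set mpow_Suc)
qed (simp add: nat_pow_ideals_set mpow_0)

lemma mpow_add: "mpow (s + t) = mpow s \<cdot> mpow t"
proof -
  interpret IS: comm_monoid "ideals_set R" by (rule ideals_set_is_comm_monoid)
  show ?thesis
    using IS.nat_pow_mult[of "mpow 1" s t] by (simp add: pow_ideals_set ideal_mpow del: One_nat_def)
qed

end

section \<open>The maximal homogeneous ideal\<close>

context stanley_reisner
begin

lemma sr_component_eq: "sr_component n \<Delta> k = {pr f | f. f \<in> carrier A \<and> homogeneous_poly k f}"
  unfolding sr_component_def pr_def by simp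

lemma one_notin_mpow_1: "\<one> \<notin> mpow 1"
  using pr_mem_mpow[of 1 1] empty_face by (simp add: poly_ring_closed pr_simps mono_deg_def)

text \<open>A homogeneous generator with nonzero constant term is a nonzero constant, hence a unit
  of R, which a proper ideal cannot contain.\<close>

lemma homogeneous_ideal_subset_mpow_1:
  assumes "homogeneous_ideal n \<Delta> J" "J \<noteq> carrier R"
  shows "J \<subseteq> mpow 1"
proof -
  obtain S where S: "S \<subseteq> (\<Union>k. sr_component n \<Delta> k)" "J = Idl S"
    using assms unfolding homogeneous_ideal_def R_def[symmetric] by blast
  then have S': "S \<subseteq> carrier R"
    by (force simp: sr_component_eq pr_closed)
  then have J: "ideal J R" "S \<subseteq> J"
    using S genideal_ideal genideal_self by blast+
  interpret J: ideal J R by fact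
  have "S \<subseteq> mpow 1"
  proof
    fix x assume x: "x \<in> S"
    then obtain k f where f: "x = pr f" "f \<in> carrier A" "homogeneous_poly k f"
      using S by (auto simp: sr_component_eq)
    show "x \<in> mpow 1"
    proof (cases "0 \<in> keys f")
      case True
      then have k: "k = 0" using f by (auto simp: homogeneous_poly_def mono_deg_def)
      then have "\<And>m. m \<in> keys f \<Longrightarrow> m = 0"
        using f by (simp add: homogeneous_poly_def mono_deg_eq_0)
      with True have "keys f = {0}" by blast
      then have eq: "f = single 0 (lookup f 0)" using sum_single_lookup[of f] by simp
      have c: "single 0 (1 / lookup f 0) \<in> carrier A" by (simp add: single_in_poly_ring)
      have "pr (single 0 (1 / lookup f 0)) \<otimes> x \<in> J"
        using c x J by (intro J.I_l_closed pr_closed) auto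
      moreover have "single 0 (1 / lookup f 0) * f = 1"
        using True by (subst (2) eq) (simp add: mult_single in_keys_iff)
      ultimately have "\<one> \<in> J"
        using f c by (metis pr_simps(2,3))
      then show ?thesis using J.one_imp_carrier assms(2) by simp
    next
      case False
      then show ?thesis
        unfolding f(1) by (intro mpowI[OF f(2)]) (metis less_one mono_deg_eq_0 not_less)
    qed
  qed
  then show ?thesis
    unfolding S by (rule genideal_minimal[OF ideal_mpow])
qed

text \<open>\<open>mpow 1\<close> is itself proper and homogeneous and contains all proper
  homogeneous ideals, so the definite description has exactly one candidate.\<close>

lemma the_maximal_homogeneous_ideal_eq: "the_maximal_homogeneous_ideal n \<Delta> = mpow 1"
proof -
  have hom: "homogeneous_ideal n \<Delta> (mpow 1)"
    unfolding homogeneous_ideal_def R_def[symmetric]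
  proof (intro exI[of _ "pr ` poly_var ` {1..n}"] conjI)
    have "pr (poly_var i) \<in> sr_component n \<Delta> 1" if "i \<in> {1..n}" for i
      unfolding sr_component_eq using poly_var_in_poly_ring[OF that]
      by (auto simp: homogeneous_poly_def poly_var_def mono_deg_single)
    then show "pr ` poly_var ` {1..n} \<subseteq> (\<Union>k. sr_component n \<Delta> k)" by blast
  qed (rule mpow_1_eq_genideal)
  have ne: "mpow 1 \<noteq> carrier R"
    using one_notin_mpow_1 one_closed by blast
  show ?thesis
    unfolding the_maximal_homogeneous_ideal_def
  proof (rule the_equality)
    show "maximal_homogeneous_ideal n \<Delta> (mpow 1)"
      using hom ne homogeneous_ideal_subset_mpow_1
      unfolding maximal_homogeneous_ideal_def R_def[symmetric] by blast
    fix M :: "'k mpoly set set" assume "maximal_homogeneous_ideal n \<Delta> M"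
    then show "M = mpow 1"
      using hom ne homogeneous_ideal_subset_mpow_1
      unfolding maximal_homogeneous_ideal_def R_def[symmetric] by blast
  qed
qed

section \<open>Tight closure\<close>

text \<open>Since J \<subseteq> m^s, equality of the images in k[F] amounts to the one inclusion
  stated last. The witness \<open>l\<close> may vary with \<open>F\<close>.\<close>

definition facetwise_reduction :: "'k mpoly set set \<Rightarrow> nat \<Rightarrow> bool" where
  "facetwise_reduction J s \<longleftrightarrow> ideal J R \<and> J \<subseteq> mpow s \<and>
     (\<forall>F\<in>facets. \<forall>x\<in>mpow s. \<exists>l\<in>J. rho F l = rho F x)"

text \<open>J^[q] lies in m^(s q). A monomial of \<open>x\<close> that is nonzero in R is supported
  on a face and survives restriction to some facet F; there \<open>c\<close> stays nonzero, and its
  fixed order of vanishing cannot make up for a deficit of \<open>x\<close> that grows linearly in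
  q.\<close>

lemma tight_closure_facetwise_reduction_subset:
  assumes J: "facetwise_reduction J s" and p: "1 < p"
  shows "tight_closure p R J \<subseteq> mpow s"
proof
  fix x assume "x \<in> tight_closure p R J"
  then obtain c e0 where x: "x \<in> carrier R" and c: "c \<in> carrier R"
    "\<And>Q. minimal_prime R Q \<Longrightarrow> c \<notin> Q"
    and e0: "\<And>e. e0 \<le> e \<Longrightarrow> c \<otimes> x [^] (p ^ e) \<in> frobenius_power R J (p ^ e)"
    unfolding tight_closure_def by blast
  obtain f g where fg: "x = pr f" "f \<in> carrier A" "c = pr g" "g \<in> carrier A"
    using x c by (auto simp: carrier_R)
  have frob: "frobenius_power R J q \<subseteq> mpow (q * s)" for q
    unfolding frobenius_power_def using J
    by (intro genideal_minimal ideal_mpow) (auto simp: facetwise_reduction_def intro: mpow_power)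
  have "s \<le> mono_deg m" if m: "m \<in> keys f" "keys m \<in> \<Delta>" for m
  proof -
    obtain F where F: "F \<in> facets" "keys m \<subseteq> F" using facet_above m by blast
    then have F': "F \<in> \<Delta>" by (simp add: facets_subset)
    show ?thesis
    proof (rule degree_ge_of_power_multiples)
      have "pr g \<notin> face_prime F"
        using c(2) F minimal_prime_iff fg by blast
      then show "face_part F g \<noteq> 0"
        using F' fg by (auto simp: pr_mem_face_prime face_part_def part_eq_0_iff)
      show "m \<in> keys (face_part F f)" using m F by (simp add: face_part_def keys_part)
      fix N
      define e where "e = max e0 N"
      have "N < p ^ e"
        using power_gt_expt[of p e] p by (simp add: e_def)
      moreover have "p ^ e * s \<le> mono_deg u" if "u \<in> keys (face_part F g * face_part F f ^ (p ^ e))" for u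
      proof -
        have "face_part F (h ^ q) = face_part F h ^ q" for h :: "'k mpoly" and q
          by (induction q) (simp_all add: face_part_1 face_part_mult)
        then have "u \<in> keys (face_part F (g * f ^ (p ^ e)))"
          using that by (simp add: face_part_mult)
        then have u: "u \<in> keys (g * f ^ (p ^ e))" "keys u \<subseteq> F"
          by (auto simp: face_part_def keys_part)
        have "pr (g * f ^ (p ^ e)) = c \<otimes> x [^] (p ^ e)"
          using fg by (simp add: pr_simps poly_ring_closed_power pr_power)
        also have "\<dots> \<in> mpow (p ^ e * s)"
          using e0[of e] frob by (auto simp: e_def)
        finally show ?thesis
          using u F' subface fg
          by (auto simp: pr_mem_mpow poly_ring_closed poly_ring_closed_power)
      qed
      ultimately show "\<exists>q>N. \<forall>u\<in>keys (face_part F g * face_part F f ^ q). q * s \<le> mono_deg u"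
        by blast
    qed
  qed
  then show "x \<in> mpow s" using fg by (simp add: pr_mem_mpow)
qed

text \<open>Multiplication by the product of the variables of a facet \<open>F\<close> only sees restrictions to \<open>F\<close>,
  so \<open>test_poly\<close> multiplies \<open>x ^ q\<close> into the Frobenius power facet by facet.\<close>

lemma tight_closure_facetwise_reduction_supset:
  assumes J: "facetwise_reduction J s"
  shows "mpow s \<subseteq> tight_closure p R J"
proof
  fix x assume x: "x \<in> mpow s"
  have x': "x \<in> carrier R" using x by (rule mpow_closed)
  have JR: "J \<subseteq> carrier R"
    using J mpow_closed by (auto simp: facetwise_reduction_def)
  have *: "pr test_poly \<otimes> x [^] q \<in> frobenius_power R J q" for q :: nat
  proof (rule test_poly_mult_mem_ideal)
    let ?S = "{x [^] q | x. x \<in> J}"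
    have S: "?S \<subseteq> carrier R" using JR by auto
    then show id: "ideal (frobenius_power R J q) R"
      unfolding frobenius_power_def by (rule genideal_ideal)
    show "x [^] q \<in> carrier R" using x' by simp
    fix F assume F: "F \<in> facets"
    then obtain l where l: "l \<in> J" "rho F l = rho F x"
      using J x unfolding facetwise_reduction_def by blast
    have l': "l \<in> carrier R" using l JR by blast
    have "pr (\<Prod>i\<in>F. poly_var i) \<otimes> x [^] q = pr (\<Prod>i\<in>F. poly_var i) \<otimes> l [^] q"
      using F x' l l' by (intro facet_prod_mult_eq) (auto simp: rho_power facets_subset)
    also have "\<dots> \<in> frobenius_power R J q"
    proof (rule ideal.I_l_closed[OF id])
      show "l [^] q \<in> frobenius_power R J q"
        unfolding frobenius_power_def using l genideal_self[OF S] by blast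
    qed (intro pr_closed prod_facet_in_poly_ring F)
    finally show "pr (\<Prod>i\<in>F. poly_var i) \<otimes> x [^] q \<in> frobenius_power R J q" .
  qed
  then show "x \<in> tight_closure p R J"
    unfolding tight_closure_def using x' test_poly_notin_minimal_prime
    by (auto intro!: bexI[of _ "pr test_poly"] pr_closed test_poly_in_poly_ring)
qed

lemma tight_closure_eq:
  "facetwise_reduction J s \<Longrightarrow> 1 < p \<Longrightarrow> tight_closure p R J = mpow s"
  using tight_closure_facetwise_reduction_subset tight_closure_facetwise_reduction_supset by blast

section \<open>Products and powers of facetwise reductions\<close>

lemma facetwise_reduction_one: "facetwise_reduction (carrier R) 0"
  unfolding facetwise_reduction_def mpow_0 using oneideal by blast

text \<open>m^(s + t) is the product of m^s and m^t, so its elements are sums of products, and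
  witnesses for the factors can be multiplied and added because \<open>rho F\<close> is a ring
  homomorphism.\<close>

lemma facetwise_reduction_prod:
  assumes J: "facetwise_reduction J s" and K: "facetwise_reduction K t"
  shows "facetwise_reduction (J \<cdot> K) (s + t)"
  unfolding facetwise_reduction_def
proof (intro conjI ballI)
  have id: "ideal J R" "ideal K R" using J K by (auto simp: facetwise_reduction_def)
  then interpret JK: ideal "J \<cdot> K" R by (intro ideal_prod_is_ideal)
  show "ideal (J \<cdot> K) R" by (rule JK.is_ideal)
  show "J \<cdot> K \<subseteq> mpow (s + t)"
  proof
    interpret M: ideal "mpow (s + t)" R by (rule ideal_mpow)
    fix x assume "x \<in> J \<cdot> K"
    then show "x \<in> mpow (s + t)"
    proof induction
      case (prod i j)
      then show ?case using J K mpow_mult unfolding facetwise_reduction_def by blast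
    qed (rule M.a_closed)
  qed
  fix F x assume F: "F \<in> facets" and "x \<in> mpow (s + t)"
  then have "x \<in> mpow s \<cdot> mpow t" by (simp add: mpow_add)
  then show "\<exists>l\<in>J \<cdot> K. rho F l = rho F x"
  proof induction
    case (prod i j)
    then obtain l l' where l: "l \<in> J" "rho F l = rho F i" "l' \<in> K" "rho F l' = rho F j"
      using J K F by (fastforce simp: facetwise_reduction_def)
    then have "rho F (l \<otimes> l') = rho F (i \<otimes> j)"
      using prod id mpow_closed facets_subset[OF F] by (simp add: rho_simps ideal.Icarr)
    then show ?case using l ideal_prod.prod by metis
  next
    case (sum x y)
    then obtain l l' where l: "l \<in> J \<cdot> K" "rho F l = rho F x" "l' \<in> J \<cdot> K" "rho F l' = rho F y"
      by blast
    have "x \<in> carrier R" "y \<in> carrier R"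
      using sum ideal_prod_in_carrier[OF ideal_mpow ideal_mpow] by blast+
    then have "rho F (l \<oplus> l') = rho F (x \<oplus> y)"
      using l facets_subset[OF F] by (simp add: rho_simps JK.Icarr)
    then show ?case using l JK.a_closed by metis
  qed
qed

lemma facetwise_reduction_pow:
  assumes "facetwise_reduction J 1"
  shows "facetwise_reduction (J [^]\<^bsub>ideals_set R\<^esub> s) s"
proof (induction s)
  case 0
  show ?case by (simp only: nat_pow_ideals_set facetwise_reduction_one)
next
  case (Suc s)
  then show ?case
    using facetwise_reduction_prod[OF Suc assms] by (simp add: nat_pow_ideals_set)
qed

lemma facetwise_reduction_finprod:
  assumes "finite S" "\<And>i. i \<in> S \<Longrightarrow> facetwise_reduction (J i) (s i)"
  shows "facetwise_reduction (\<Otimes>\<^bsub>ideals_set R\<^esub>i\<in>S. J i) (\<Sum>i\<in>S. s i)"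
  using assms
proof (induction S rule: finite_induct)
  interpret IS: comm_monoid "ideals_set R" by (rule ideals_set_is_comm_monoid)
  case empty
  show ?case using facetwise_reduction_one by simp
next
  interpret IS: comm_monoid "ideals_set R" by (rule ideals_set_is_comm_monoid)
  case (insert i S)
  have "J \<in> insert i S \<rightarrow> carrier (ideals_set R)"
    using insert.prems by (auto simp: facetwise_reduction_def)
  then have "(\<Otimes>\<^bsub>ideals_set R\<^esub>i\<in>insert i S. J i) = J i \<cdot> (\<Otimes>\<^bsub>ideals_set R\<^esub>i\<in>S. J i)"
    using insert.hyps by (subst IS.finprod_insert) auto
  then show ?case
    using insert facetwise_reduction_prod[of "J i" "s i"] by simp
qed

end

section \<open>Linear systems of parameters\<close>

text \<open>The constant polynomials act as scalars and make \<open>V\<close> a subspace. A basis of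
  \<open>V\<close> together with \<open>v\<close> is independent, so a functional can be prescribed
  as 0 on the former and 1 on \<open>v\<close>.\<close>

lemma separating_functional:
  fixes V :: "('k::field) mpoly set"
  assumes V: "0 \<in> V" "\<And>f g. f \<in> V \<Longrightarrow> g \<in> V \<Longrightarrow> f + g \<in> V" "\<And>c f. f \<in> V \<Longrightarrow> single 0 c * f \<in> V"
    and v: "v \<notin> V"
  shows "\<exists>\<phi> :: 'k mpoly \<Rightarrow> 'k. (\<forall>f g. \<phi> (f + g) = \<phi> f + \<phi> g) \<and>
    (\<forall>c f. \<phi> (single 0 c * f) = c * \<phi> f) \<and> (\<forall>f\<in>V. \<phi> f = 0) \<and> \<phi> v = 1"
proof -
  let ?s = "\<lambda>c (f :: 'k mpoly). single 0 c * f"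
  have vs: "vector_space ?s"
    by unfold_locales (simp_all add: algebra_simps single_add mult_single flip: mult.assoc)
  have vs': "vector_space ((*) :: 'k \<Rightarrow> 'k \<Rightarrow> 'k)"
    by unfold_locales (simp_all add: algebra_simps)
  interpret vector_space_pair ?s "(*)"
    using vs vs' by (rule vector_space_pair.intro)
  obtain B where B: "B \<subseteq> V" "vs1.independent B" "V \<subseteq> vs1.span B"
    by (rule vs1.maximal_independent_subset)
  have "vs1.subspace V" by (rule vs1.subspaceI) (use V in auto)
  then have "vs1.span B \<subseteq> V" using B by (intro vs1.span_minimal)
  then have ind: "vs1.independent (insert v B)"
    using v B by (intro vs1.independent_insertI) auto
  define \<phi> where "\<phi> = construct (insert v B) (\<lambda>b. if b = v then 1 else 0)"
  interpret \<phi>: Vector_Spaces.linear ?s "(*)" \<phi>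
    unfolding \<phi>_def by (rule linear_construct[OF ind])
  have \<phi>: "\<phi> b = (if b = v then 1 else 0)" if "b \<in> insert v B" for b
    unfolding \<phi>_def by (rule construct_basis[OF ind that])
  have "\<phi> f = 0" if "f \<in> V" for f
  proof (rule linear_eq_0_on_span[OF \<phi>.linear_axioms])
    show "f \<in> vs1.span B" using that B by blast
    show "\<phi> b = 0" if "b \<in> B" for b using \<phi>[of b] that v B by auto
  qed
  then show ?thesis
    using \<phi>[of v] by (intro exI[of _ \<phi>]) (simp add: \<phi>.add \<phi>.scale)
qed

text \<open>As I \<subseteq> Q, the prime is a union of cosets of I, so any representative decides
  membership in the image. Primality, and strictness of inclusions, then pass to the
  quotient.\<close>

lemma (in cring) primeideal_quotient_image:
  assumes I: "ideal I R" and Q: "primeideal Q R" and sub: "I \<subseteq> Q"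
  shows "primeideal ((+>) I ` Q) (R Quot I)"
    and "\<And>a. a \<in> carrier R \<Longrightarrow> I +> a \<in> (+>) I ` Q \<longleftrightarrow> a \<in> Q"
proof -
  interpret I: ideal I R by fact
  interpret Q: primeideal Q R by fact
  interpret h: ring_hom_cring R "R Quot I" "(+>) I"
    by (rule I.rcos_ring_hom_cring) (rule is_cring)
  show mem: "I +> a \<in> (+>) I ` Q \<longleftrightarrow> a \<in> Q" if a: "a \<in> carrier R" for a
  proof
    assume "I +> a \<in> (+>) I ` Q"
    then obtain b where b: "b \<in> Q" "I +> a = I +> b" by blast
    then have "a \<ominus> b \<in> Q"
      using quotient_eq_iff_same_a_r_cos[OF I a] sub by (auto simp: Q.Icarr)
    then have "(a \<ominus> b) \<oplus> b \<in> Q" using b by (intro Q.a_closed)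
    then show "a \<in> Q" using a b by (simp add: Q.Icarr a_minus_def a_assoc l_neg)
  qed simp
  note carr = carrier_FactRing[of R I]
  show "primeideal ((+>) I ` Q) (R Quot I)"
  proof (rule primeidealI)
    show "ideal ((+>) I ` Q) (R Quot I)"
      using ring_ideal_imp_quot_ideal[OF I Q.is_ideal] .
    show "carrier (R Quot I) \<noteq> (+>) I ` Q"
      using mem[OF one_closed] Q.one_imp_carrier Q.I_notcarr one_closed unfolding carr by blast
    fix x y assume "x \<in> carrier (R Quot I)" "y \<in> carrier (R Quot I)"
      and xy: "x \<otimes>\<^bsub>R Quot I\<^esub> y \<in> (+>) I ` Q"
    then obtain a b where ab: "x = I +> a" "y = I +> b" "a \<in> carrier R" "b \<in> carrier R"
      unfolding carr by blast
    with xy have "I +> (a \<otimes> b) \<in> (+>) I ` Q" by (simp only: h.hom_mult)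
    then have "a \<in> Q \<or> b \<in> Q"
      using ab mem[of "a \<otimes> b"] Q.I_prime by simp
    then show "x \<in> (+>) I ` Q \<or> y \<in> (+>) I ` Q"
      using ab by blast
  qed (rule I.quotient_is_cring[OF is_cring])
qed

context stanley_reisner
begin

text \<open>Restriction to the empty face keeps only the constant term. The irrelevant ideal thereby
  inherits primality from the face primes.\<close>

lemma mpow_1_eq_face_prime: "mpow 1 = face_prime {}"
proof -
  have "pr f \<in> mpow 1 \<longleftrightarrow> pr f \<in> face_prime {}" if "f \<in> carrier A" for f
  proof -
    have "(keys m \<in> \<Delta> \<longrightarrow> 1 \<le> mono_deg m) \<longleftrightarrow> \<not> keys m \<subseteq> {}" for m :: "nat \<Rightarrow>\<^sub>0 nat"
      using empty_face mono_deg_eq_0[of m] by (cases "m = 0") auto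
    then show ?thesis
      using that empty_face by (simp only: pr_mem_mpow pr_mem_face_prime)
  qed
  then show ?thesis
    using mpow_closed by (auto simp: face_prime_def carrier_R)
qed

text \<open>If the linear forms of \<open>I\<close> did not span all linear forms on \<open>F\<close>, they would vanish on a line
  in the coordinate subspace of \<open>F\<close>; the prime of that line lies strictly between \<open>I\<close> and the
  irrelevant ideal.\<close>

lemma linear_sop_covers_variable:
  assumes "linear_sop n \<Delta> \<theta>" and I_def: "I = Idl (set \<theta>)" and F: "F \<in> \<Delta>" and j: "j \<in> F"
  shows "\<exists>l\<in>I. rho F l = poly_var j"
proof (rule ccontr)
  assume no: "\<not> ?thesis"
  have lin: "set \<theta> \<subseteq> sr_component n \<Delta> 1"
    and dim0: "has_krull_dim (R Quot I) 0"
    using assms(1) unfolding linear_sop_def homogeneous_sop_def R_def[symmetric] I_def by auto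
  have \<theta>: "set \<theta> \<subseteq> carrier R"
    using lin by (auto simp: sr_component_eq pr_closed)
  then have I: "ideal I R" unfolding I_def by (rule genideal_ideal)
  interpret I: ideal I R by fact
  \<comment> \<open>All linear forms with class in I are taken, not just the given parameters, so
    that closure under sums and scalars is inherited from the ideal I.\<close>
  define V where "V = {face_part F f | f. f \<in> carrier A \<and> homogeneous_poly 1 f \<and> pr f \<in> I}"
  have V: "0 \<in> V"
    unfolding V_def using I.zero_closed
    by (auto intro!: exI[of _ 0] simp: poly_ring_closed homogeneous_poly_def face_part_def pr_simps)
  have V_add: "f + g \<in> V" if fg: "f \<in> V" "g \<in> V" for f g
  proof -
    obtain f' g' where *: "f = face_part F f'" "g = face_part F g'" "f' \<in> carrier A" "g' \<in> carrier A"
      "homogeneous_poly 1 f'" "homogeneous_poly 1 g'" "pr f' \<in> I" "pr g' \<in> I"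
      using fg unfolding V_def by blast
    then have "homogeneous_poly 1 (f' + g')"
      using keys_add[of f' g'] by (auto simp: homogeneous_poly_def)
    then show ?thesis
      unfolding V_def using *
      by (auto intro!: exI[of _ "f' + g'"] simp: face_part_add poly_ring_closed pr_simps I.a_closed)
  qed
  have V_scale: "single 0 c * f \<in> V" if f: "f \<in> V" for c f
  proof -
    obtain f' where *: "f = face_part F f'" "f' \<in> carrier A" "homogeneous_poly 1 f'" "pr f' \<in> I"
      using f unfolding V_def by blast
    have c: "single 0 c \<in> carrier A" by (simp add: single_in_poly_ring)
    have "homogeneous_poly 1 (single 0 c * f')"
      using keys_mult[of "single 0 c" f'] * by (auto simp: homogeneous_poly_def split: if_splits)
    moreover have "face_part F (single 0 c) = single 0 c"
      unfolding face_part_def by (rule part_eq_self) (auto split: if_splits)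
    ultimately show ?thesis
      unfolding V_def using * c
      by (auto intro!: exI[of _ "single 0 c * f'"] I.I_l_closed
          simp: face_part_mult poly_ring_closed pr_simps pr_closed)
  qed
  have "poly_var j \<notin> V"
    using no F unfolding V_def by (auto simp: rho_pr)
  then obtain \<phi> :: "'k mpoly \<Rightarrow> 'k" where \<phi>_all: "\<forall>f g. \<phi> (f + g) = \<phi> f + \<phi> g"
    "\<forall>c f. \<phi> (single 0 c * f) = c * \<phi> f" "\<forall>f\<in>V. \<phi> f = 0" "\<phi> (poly_var j) = 1"
    using separating_functional[OF V V_add V_scale, of "poly_var j"] by blast
  note \<phi> = \<phi>_all(1,2)[rule_format] \<phi>_all(3)[THEN bspec] \<phi>_all(4)
  have \<phi>_0: "\<phi> 0 = 0" using \<phi>(3) V by blast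
  have \<phi>_sum: "\<phi> (sum f S) = (\<Sum>x\<in>S. \<phi> (f x))" for f :: "(nat \<Rightarrow>\<^sub>0 nat) \<Rightarrow> 'k mpoly" and S
    by (induction S rule: infinite_finite_induct) (auto simp: \<phi> \<phi>_0)
  \<comment> \<open>A functional on linear forms is evaluation at the point of its values on the
    variables. The zeros outside \<open>F\<close> put this point into the coordinate subspace of
    \<open>F\<close>.\<close>
  define a where "a = (\<lambda>i. if i \<in> F then \<phi> (poly_var i) else 0)"
  have le_face: "line_eval a (face_part F f) = line_eval a f" for f
    by (rule line_eval_face_part) (simp add: a_def)
  have le_kills: "line_eval a f = 0" if "f \<in> sr_ideal n \<Delta>" for f
    using face_part_kills[OF F that] le_face[of f] by (simp add: line_eval_def)
  note le_hom = line_eval_add line_eval_mult line_eval_1 le_kills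
  define L where "L = {x \<in> carrier R. descend (line_eval a) x = 0}"
  have L: "primeideal L R"
    unfolding L_def by (rule primeideal_descend[OF le_hom])
  have pr_mem_L: "pr f \<in> L \<longleftrightarrow> line_eval a f = 0" if "f \<in> carrier A" for f
    using that descend_pr[OF le_hom that] by (simp add: L_def pr_closed)
  have "set \<theta> \<subseteq> L"
  proof
    fix x assume x: "x \<in> set \<theta>"
    then obtain f where f: "x = pr f" "f \<in> carrier A" "homogeneous_poly 1 f"
      using lin by (auto simp: sr_component_eq)
    have "x \<in> I" unfolding I_def using x genideal_self[OF \<theta>] by blast
    let ?f = "face_part F f"
    have "?f \<in> V" using f \<open>x \<in> I\<close> unfolding V_def by blast
    \<comment> \<open>On monomials of degree 1 supported in \<open>F\<close>, \<phi> is evaluation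
      at \<open>a\<close>. Expanding \<phi> of the restricted form therefore computes the
      coefficient of t in its pullback, which must be 0.\<close>
    then have "0 = \<phi> (\<Sum>m\<in>keys ?f. single 0 (lookup ?f m) * single m 1)"
      by (simp add: \<phi>(3) mult_single sum_single_lookup)
    also have "\<dots> = (\<Sum>m\<in>keys ?f. lookup ?f m * \<phi> (single m 1))"
      by (simp add: \<phi>_sum \<phi>)
    also have "\<dots> = (\<Sum>m\<in>keys ?f. lookup ?f m * (\<Prod>i\<in>keys m. a i ^ lookup m i))"
    proof (intro sum.cong refl arg_cong2[of _ _ _ _ "(*)"])
      fix m assume "m \<in> keys ?f"
      then have m: "mono_deg m = 1" "keys m \<subseteq> F"
        using f by (auto simp: face_part_def keys_part homogeneous_poly_def)
      then obtain i where i: "m = single i 1" using mono_deg_1 by blast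
      with m show "\<phi> (single m 1) = (\<Prod>i\<in>keys m. a i ^ lookup m i)"
        by (simp add: a_def poly_var_def)
    qed
    finally have "line_eval a ?f = 0"
      using f by (subst line_eval_linear) (auto simp: homogeneous_poly_def face_part_def keys_part)
    then show "x \<in> L"
      using f by (simp add: pr_mem_L le_face)
  qed
  then have IL: "I \<subseteq> L"
    unfolding I_def by (rule genideal_minimal[OF primeideal.axioms(1)[OF L]])
  have LM: "L \<subseteq> mpow 1"
  proof
    fix x assume x: "x \<in> L"
    then obtain f where f: "x = pr f" "f \<in> carrier A" by (auto simp: L_def carrier_R)
    then have "line_eval a f = 0" using x by (simp add: pr_mem_L)
    then have "lookup f 0 = 0" by (metis lookup_line_eval_0 lookup_zero)
    then show "x \<in> mpow 1"
      unfolding f(1) by (intro mpowI f(2)) (metis in_keys_iff less_one mono_deg_eq_0 not_less)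
  qed
  have jn: "j \<in> {1..n}" using F j face_subset by blast
  then have pv: "poly_var j \<in> carrier A" by (rule poly_var_in_poly_ring)
  \<comment> \<open>The j-th coordinate of \<open>a\<close> is 1, so this variable pulls back to t
    and separates the prime of the line from the irrelevant ideal.\<close>
  have "line_eval a (poly_var j) = single 1 1"
    using \<phi>(4) j by (simp add: poly_var_def line_eval_def monomial_hom_single mono_deg_single a_def)
  then have "line_eval a (poly_var j) \<noteq> 0"
    by (metis lookup_single_eq lookup_zero zero_neq_one)
  then have jL: "pr (poly_var j) \<notin> L" using pv by (simp add: pr_mem_L)
  have M: "primeideal (mpow 1) R"
    unfolding mpow_1_eq_face_prime by (rule primeideal_face_prime[OF empty_face])
  \<comment> \<open>A chain of length 1 has two primes, one step more than dimension 0
    allows.\<close>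
  have "prime_chain (R Quot I) 1"
    unfolding prime_chain_def
  proof (intro exI conjI allI impI)
    let ?Q = "\<lambda>i. (+>) I ` (if i = 0 then L else mpow 1)"
    show "primeideal (?Q i) (R Quot I)" for i :: nat
      using primeideal_quotient_image(1)[OF I] L M IL LM by auto
    have "I +> pr (poly_var j) \<notin> (+>) I ` L"
      using primeideal_quotient_image(2)[OF I L IL] jL pv pr_closed by blast
    moreover have "I +> pr (poly_var j) \<in> (+>) I ` mpow 1"
      using poly_var_mem_mpow[OF jn] by blast
    ultimately show "?Q i \<subset> ?Q (Suc i)" if "i < 1" for i :: nat
      using that LM by auto
  qed
  then show False
    using dim0 unfolding has_krull_dim_def by fastforce
qed

lemma rho_add_face_prime:
  "F \<in> \<Delta> \<Longrightarrow> x \<in> carrier R \<Longrightarrow> y \<in> face_prime F \<Longrightarrow> rho F (x \<oplus> y) = rho F x"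
  by (simp add: face_prime_def rho_simps)

lemma minus_mem_face_prime:
  assumes "F \<in> \<Delta>" "x \<in> carrier R" "y \<in> carrier R" "rho F x = rho F y"
  shows "x \<ominus> y \<in> face_prime F"
proof -
  have "rho F (x \<ominus> y) + rho F y = rho F x"
    using assms by (simp add: a_minus_def a_assoc l_neg flip: rho_simps)
  then show ?thesis
    using assms by (simp add: face_prime_def)
qed

text \<open>It suffices to place the variables in the ideal I + P, where P is the face prime of F,
  since they generate m. A variable of F agrees modulo P with an element of I; one outside F lies in
  P, and the witness is 0.\<close>

lemma facetwise_reduction_linear_sop:
  assumes \<theta>: "linear_sop n \<Delta> \<theta>" and I_def: "I = Idl (set \<theta>)"
  shows "facetwise_reduction I 1"
  unfolding facetwise_reduction_def
proof (intro conjI ballI)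
  have lin: "set \<theta> \<subseteq> sr_component n \<Delta> 1"
    using \<theta> unfolding linear_sop_def by blast
  then have "set \<theta> \<subseteq> carrier R" by (auto simp: sr_component_eq pr_closed)
  then show id: "ideal I R" unfolding I_def by (rule genideal_ideal)
  have "set \<theta> \<subseteq> mpow 1"
  proof
    fix x assume "x \<in> set \<theta>"
    then obtain f where "x = pr f" "f \<in> carrier A" "homogeneous_poly 1 f"
      using lin by (auto simp: sr_component_eq)
    then show "x \<in> mpow 1" by (auto simp: homogeneous_poly_def intro: mpowI)
  qed
  then show "I \<subseteq> mpow 1" unfolding I_def by (rule genideal_minimal[OF ideal_mpow])
  fix F x assume "F \<in> facets" and x: "x \<in> mpow 1"
  then have F: "F \<in> \<Delta>" by (simp add: facets_subset)
  interpret I: ideal I R by fact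
  interpret K: primeideal "face_prime F" R using F by (rule primeideal_face_prime)
  have sum: "ideal (I <+> face_prime F) R"
    using id K.is_ideal by (rule add_ideals)
  have "mpow 1 \<subseteq> I <+> face_prime F"
    unfolding mpow_1_eq_genideal
  proof (intro genideal_minimal[OF sum], clarify)
    fix j assume j: "j \<in> {1..n}"
    then have c: "poly_var j \<in> carrier A" "pr (poly_var j) \<in> carrier R"
      by (simp_all add: poly_var_in_poly_ring pr_closed)
    obtain l where l: "l \<in> I" "rho F l = rho F (pr (poly_var j))"
    proof (cases "j \<in> F")
      case True
      then have "face_part F (poly_var j :: 'k mpoly) = poly_var j"
        unfolding face_part_def by (intro part_eq_self) (auto simp: poly_var_def)
      then show ?thesis
        using linear_sop_covers_variable[OF \<theta> I_def F True] that F c by (auto simp: rho_pr)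
    next
      case False
      then have "pr (poly_var j) \<in> face_prime F"
        using poly_var_mem_face_prime[OF F j] by blast
      then have "rho F (pr (poly_var j)) = 0"
        unfolding face_prime_def by blast
      then show ?thesis
        using that[OF I.zero_closed] by (simp only: rho_simps(4)[OF F])
    qed
    have l': "l \<in> carrier R" using l by (simp add: I.Icarr)
    define k where "k = pr (poly_var j) \<ominus> l"
    have "pr (poly_var j) = l \<oplus> k"
      using c l' by (simp add: k_def a_minus_def a_lcomm[of l] r_neg)
    moreover have "k \<in> face_prime F"
      unfolding k_def using l(2) by (intro minus_mem_face_prime F c(2) l') simp
    ultimately show "pr (poly_var j) \<in> I <+> face_prime F"
      using l(1) unfolding set_add_def' by blast
  qed
  then obtain l k where lk: "l \<in> I" "k \<in> face_prime F" "x = l \<oplus> k"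
    using x unfolding set_add_def' by blast
  show "\<exists>l\<in>I. rho F l = rho F x"
    unfolding lk(3) using lk(1) rho_add_face_prime[OF F I.Icarr[OF lk(1)] lk(2)] by (metis (no_types))
qed

end

theorem theorem6p1:
  fixes n d p g :: nat
    and \<Delta> :: "nat set set"
    and R :: "(('k::field) mpoly set) ring"
    and \<mm> :: "'k mpoly set set"
    and I :: "nat \<Rightarrow> 'k mpoly set set"
  assumes complex: "simplicial_complex n \<Delta>"
    and dim: "complex_dim \<Delta> = int d - 1"
    and char: "Factorial_Ring.prime p" "CHAR('k) = p"
    and R: "R = sr_ring n \<Delta>"
    and \<mm>: "\<mm> = the_maximal_homogeneous_ideal n \<Delta>"
    and I: "\<And>i. i \<in> {1..g} \<Longrightarrow> \<exists>\<theta>. linear_sop n \<Delta> \<theta> \<and> I i = Idl\<^bsub>R\<^esub> (set \<theta>)"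
  shows "(\<forall>i\<in>{1..g}. tight_closure p R (I i) = \<mm>) \<and>
    (\<forall>s :: nat \<Rightarrow> nat.
       tight_closure p R (\<Otimes>\<^bsub>ideals_set R\<^esub>i\<in>{1..g}. I i [^]\<^bsub>ideals_set R\<^esub> s i)
         = \<mm> [^]\<^bsub>ideals_set R\<^esub> (\<Sum>i\<in>{1..g}. s i))"
proof (intro conjI ballI allI)
  interpret stanley_reisner n \<Delta> R
    using complex R by unfold_locales
  have p: "1 < p" using char(1) by (rule prime_gt_1_nat)
  have red: "facetwise_reduction (I i) 1" if "i \<in> {1..g}" for i
    using I[OF that] facetwise_reduction_linear_sop by blast
  show "tight_closure p R (I i) = \<mm>" if "i \<in> {1..g}" for i
    using tight_closure_eq[OF red[OF that] p] by (simp add: \<mm> the_maximal_homogeneous_ideal_eq)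
  show "tight_closure p R (\<Otimes>\<^bsub>ideals_set R\<^esub>i\<in>{1..g}. I i [^]\<^bsub>ideals_set R\<^esub> s i)
         = \<mm> [^]\<^bsub>ideals_set R\<^esub> (\<Sum>i\<in>{1..g}. s i)" for s :: "nat \<Rightarrow> nat"
  proof -
    \<comment> \<open>For g = 0 the product is the unit of the monoid of ideals, namely R = m^0,
      which is the pair (R, 0).\<close>
    have "facetwise_reduction (\<Otimes>\<^bsub>ideals_set R\<^esub>i\<in>{1..g}. I i [^]\<^bsub>ideals_set R\<^esub> s i)
        (\<Sum>i\<in>{1..g}. s i)"
      by (intro facetwise_reduction_finprod facetwise_reduction_pow red) auto
    then show ?thesis
      unfolding \<mm> the_maximal_homogeneous_ideal_eq pow_ideals_set by (rule tight_closure_eq[OF _ p])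
  qed
qed

end
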